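(* Let $m\ge1$, $1\leq p<2$, and let $\omega$ be a continuous nondecreasing function on $[0,+\infty)$ with $\omega(0)=0$; let $\chi(\delta)=\delta\omega(\delta)$ and let $\chi^{-1}$ be its inverse function. Let $V$ be a domain in $[0,2\pi]^m$ and let $\varphi\in C^{1,\omega}(V)$ be a real function such that $\nabla\varphi(V)$ has positive Lebesgue measure. Then there is $c>0$ independent of $\lambda$ such that $$\|e^{i\lambda\varphi}\|_{A_p(\mathbb T^m,V)}\geq c\Big(|\lambda|^{1/p}\chi^{-1}\Big(\frac1{|\lambda|}\Big)\Big)^m$$ for all $\lambda\in\mathbb R$ with $|\lambda|\geq1$ for which $e^{i\lambda\varphi}\in A_p(\mathbb T^m,V)$.
   Context: $\mathbb T^m=\mathbb R^m/2\pi\mathbb Z^m$; functions on $\mathbb T^m$ are identified with functions on $\mathbb R^m$ that are $2\pi$-periodic in each variable. For integrable $f$ on $\mathbb T^m$, $\widehat f(k)=(2\pi)^{-m}\int_{\mathbb T^m}f(t)e^{-i(k,t)}dt$. $A_1(\mathbb T^m)$ is the space of continuous $f$ with $\widehat f\in l^1(\mathbb Z^m)$; for $1<p\le2$, $A_p(\mathbb T^m)$ is the space of integrable $f$ with $\widehat f\in l^p(\mathbb Z^m)$; $\|f\|_{A_p(\mathbb T^m)}=\|\widehat f\|_{l^p(\mathbb Z^m)}$. For a set $E\subseteq[0,2\pi]^m$, a function $f$ on $E$ belongs to $A_p(\mathbb T^m,E)$ if there is $F\in A_p(\mathbb T^m)$ whose restriction to $E$ equals $f$; $\|f\|_{A_p(\mathbb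 T^m,E)}=\inf\{\|F\|_{A_p(\mathbb T^m)}: F|_E=f\}$. For a domain $V\subseteq\mathbb R^m$ and $g$ on $V$, $\omega(V,g,\delta)=\sup\{|g(t_1)-g(t_2)|:t_1,t_2\in V,|t_1-t_2|\le\delta\}$; $C^{1,\omega}(V)$ is the class of functions on $V$ whose first-order partial derivatives $g$ satisfy $\omega(V,g,\delta)=O(\omega(\delta))$ as $\delta\to+0$. *)

theory Defs
  imports "HOL-Analysis.Analysis"
begin

text \<open>The torus T^m is modelled by functions on real^'n (m = CARD('n)) that are
  2pi-periodic in each coordinate; frequencies are vectors in int^'n.\<close>

definition torus_cube :: "(real^'n) set" where
  "torus_cube = cbox 0 ((2*pi) *\<^sub>R One)"

definition periodic_T :: "(real^'n \<Rightarrow> complex) \<Rightarrow> bool" where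
  "periodic_T F \<longleftrightarrow> (\<forall>x i. F (x + (2*pi) *\<^sub>R axis i 1) = F x)"

definition int_inner :: "int^'n \<Rightarrow> real^'n \<Rightarrow> real" where
  "int_inner k t = (\<Sum>i\<in>UNIV. of_int (k $ i) * t $ i)"

definition fourier_coeff :: "(real^'n \<Rightarrow> complex) \<Rightarrow> int^'n \<Rightarrow> complex" where
  "fourier_coeff F k = complex_of_real ((2*pi) powr (- real CARD('n))) *
      integral torus_cube (\<lambda>t. F t * cis (- int_inner k t))"

definition Ap_space :: "real \<Rightarrow> (real^'n \<Rightarrow> complex) set" where
  "Ap_space p = {F. periodic_T F \<and> F absolutely_integrable_on torus_cube
      \<and> (p = 1 \<longrightarrow> continuous_on UNIV F)
      \<and> (\<lambda>k. norm (fourier_coeff F k) powr p) summable_on UNIV}"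

definition Ap_norm :: "real \<Rightarrow> (real^'n \<Rightarrow> complex) \<Rightarrow> real" where
  "Ap_norm p F = (infsum (\<lambda>k. norm (fourier_coeff F k) powr p) UNIV) powr (1/p)"

definition Ap_on :: "real \<Rightarrow> (real^'n) set \<Rightarrow> (real^'n \<Rightarrow> complex) set" where
  "Ap_on p E = {f. \<exists>F\<in>Ap_space p. \<forall>x\<in>E. F x = f x}"

definition Ap_on_norm :: "real \<Rightarrow> (real^'n) set \<Rightarrow> (real^'n \<Rightarrow> complex) \<Rightarrow> real" where
  "Ap_on_norm p E f = Inf {Ap_norm p F | F. F \<in> Ap_space p \<and> (\<forall>x\<in>E. F x = f x)}"

definition partial_deriv :: "(real^'n \<Rightarrow> real) \<Rightarrow> 'n \<Rightarrow> real^'n \<Rightarrow> real" where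
  "partial_deriv \<phi> i x = deriv (\<lambda>s. \<phi> (x + s *\<^sub>R axis i 1)) 0"

definition gradient :: "(real^'n \<Rightarrow> real) \<Rightarrow> real^'n \<Rightarrow> real^'n" where
  "gradient \<phi> x = (\<chi> i. partial_deriv \<phi> i x)"

text \<open>omega(V,g,delta) = O(omega(delta)) as delta \<rightarrow> +0, with the supremum unfolded.\<close>
definition C1_omega :: "(real \<Rightarrow> real) \<Rightarrow> (real^'n) set \<Rightarrow> (real^'n \<Rightarrow> real) \<Rightarrow> bool" where
  "C1_omega \<omega> V \<phi> \<longleftrightarrow>
     (\<forall>x\<in>V. \<forall>i. (\<lambda>s. \<phi> (x + s *\<^sub>R axis i 1)) differentiable (at 0)) \<and>
     (\<forall>i. \<exists>C \<delta>0. \<delta>0 > 0 \<and> (\<forall>\<delta>. 0 < \<delta> \<and> \<delta> < \<delta>0 \<longrightarrow>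
        (\<forall>t1\<in>V. \<forall>t2\<in>V. dist t1 t2 \<le> \<delta> \<longrightarrow>
           \<bar>partial_deriv \<phi> i t1 - partial_deriv \<phi> i t2\<bar> \<le> C * \<omega> \<delta>)))"

definition chi_inv :: "(real \<Rightarrow> real) \<Rightarrow> real \<Rightarrow> real" where
  "chi_inv \<omega> y = (THE \<delta>. \<delta> \<ge> 0 \<and> \<delta> * \<omega> \<delta> = y)"

end

theory Submission
  imports Defs
begin

text \<open>Put \<open>h = \<epsilon> * \<delta>\<close> with \<open>\<delta> * \<omega> \<delta> = 1 / \<bar>lam\<bar>\<close> and \<open>\<epsilon>\<close> a small constant. On a cube of side \<open>2 * h\<close>
  around \<open>t0 \<in> V\<close> the function \<open>lam * \<phi>\<close> is affine up to a bounded error, so a product of tent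
  functions of width \<open>h\<close> centred at \<open>t0\<close>, multiplied by an extension \<open>F\<close> of \<open>cis (lam * \<phi>)\<close>, has a
  Fourier coefficient of size at least \<open>const * h ^ m\<close> at the integer point nearest to
  \<open>lam * gradient \<phi> t0\<close>. The tent functions have nonnegative Fourier coefficients with sum 1, hence
  multiplication by them does not increase the \<open>l^p\<close> norm of the Fourier coefficients; since the
  moduli of these coefficients do not depend on \<open>t0\<close>, one convolution kernel dominates all the
  localisations simultaneously. Finally, as the gradient image has positive measure, at least
  \<open>const * \<bar>lam\<bar> ^ m\<close> integer points arise in this way.\<close>

subsection \<open>The cosine series of the tent function\<close>

text \<open>Termwise differentiation yields minus the sum of
  \<open>r ^ n * sin (real n * t) / real n\<close>, which is the imaginary part of the power series
  of \<open>Ln\<close> at \<open>1 - of_real r * cis t\<close>. The damping \<open>r < 1\<close>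
  supplies a geometric majorant for the differentiated series; the limit r -> 1 is taken
  later.\<close>

lemma abel_cos_series_derivative:
  assumes r: "0 \<le> r" "r < 1"
  shows "((\<lambda>t. \<Sum>n. r ^ n * cos (real n * t) / (real n)\<^sup>2) has_field_derivative
           Im (Ln (1 - of_real r * cis t))) (at t)"
proof -
  have nz: "norm (- (of_real r * cis t)) < 1" for t
    using r by (simp add: norm_mult)
  have sm: "(\<lambda>n. - (r ^ n * sin (real n * t) / real n)) sums Im (Ln (1 - of_real r * cis t))" for t
  proof -
    have "(\<lambda>n. Im (- ((- (- (of_real r * cis t))) ^ n) / of_nat n)) sums Im (Ln (1 + - (of_real r * cis t)))"
      by (rule sums_Im[OF Ln_series'[OF nz]])
    moreover have "Im (- ((- (- (of_real r * cis t))) ^ n) / of_nat n) = - (r ^ n * sin (real n * t) / real n)" for n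
    proof -
      have "(of_real r * cis t) ^ n = of_real (r ^ n) * cis (real n * t)"
        by (simp add: power_mult_distrib Complex.DeMoivre)
      hence "Im ((of_real r * cis t) ^ n / of_nat n) = r ^ n * sin (real n * t) / real n"
        by (simp only: Im_divide_of_nat) simp
      thus ?thesis by (metis minus_divide_left minus_minus uminus_complex.sel(2))
    qed
    ultimately show ?thesis by (simp only: diff_conv_add_uminus)
  qed
  have bnd: "uniformly_convergent_on UNIV (\<lambda>n t. \<Sum>i<n. - (r ^ i * sin (real i * t) / real i))"
  proof (rule Weierstrass_m_test')
    show "norm (- (r ^ n * sin (real n * t) / real n)) \<le> r ^ n" for n t
    proof (cases "n = 0")
      case False
      have "\<bar>sin (real n * t)\<bar> / real n \<le> 1"
        using False by (simp add: divide_le_eq order_trans[OF abs_sin_le_one])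
      hence "r ^ n * (\<bar>sin (real n * t)\<bar> / real n) \<le> r ^ n * 1" using r by (intro mult_left_mono) auto
      thus ?thesis using r by (simp add: abs_mult)
    qed auto
    show "summable (\<lambda>n. r ^ n)" using r by (simp add: summable_geometric)
  qed
  have s0: "summable (\<lambda>n. r ^ n * cos (real n * 0) / (real n)\<^sup>2)"
  proof (rule summable_comparison_test'[where N=0])
    show "summable (\<lambda>n. r ^ n)" using r by (simp add: summable_geometric)
    show "norm (r ^ n * cos (real n * 0) / (real n)\<^sup>2) \<le> r ^ n" for n
    proof (cases "n = 0")
      case False
      hence "1 \<le> (real n)\<^sup>2" by (simp add: Suc_le_eq)
      thus ?thesis using r by (simp add: divide_le_eq mult_left_mono[of 1 "(real n)\<^sup>2" "r^n", simplified])
    qed auto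
  qed
  have "((\<lambda>t. \<Sum>n. r ^ n * cos (real n * t) / (real n)\<^sup>2) has_field_derivative
           (\<Sum>n. - (r ^ n * sin (real n * t) / real n))) (at t)"
  proof (rule has_field_derivative_series'(2)[where S=UNIV and ?x0.0=0 and f="\<lambda>n t. r ^ n * cos (real n * t) / (real n)\<^sup>2"])
    show "summable (\<lambda>n. r ^ n * cos (real n * 0) / (real n)\<^sup>2)" by (rule s0)
    show "uniformly_convergent_on UNIV (\<lambda>n t. \<Sum>i<n. - (r ^ i * sin (real i * t) / real i))" by (rule bnd)
    show "((\<lambda>t. r ^ n * cos (real n * t) / (real n)\<^sup>2) has_field_derivative - (r ^ n * sin (real n * t) / real n)) (at t within UNIV)" for n t
      by (cases "n = 0") (auto intro!: derivative_eq_intros simp: field_simps power2_eq_square)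
  qed auto
  with sm[of t] show ?thesis by (simp add: sums_iff)
qed

text \<open>Half-angle formulas factor \<open>1 - cis t\<close> into the positive number
  \<open>2 * sin (t/2)\<close> and a unit of argument \<open>(t - pi) / 2\<close>, which lies in the
  principal range.\<close>

lemma Im_Ln_one_minus_cis:
  assumes "0 < t" "t < 2 * pi"
  shows "Im (Ln (1 - cis t)) = (t - pi) / 2"
proof -
  have "1 - cis t = of_real (2 * sin (t/2)) * exp (\<i> * of_real ((t - pi) / 2))"
  proof -
    have c: "cos t = 1 - 2 * (sin (t/2))\<^sup>2" "sin t = 2 * sin (t/2) * cos (t/2)"
      using cos_double_sin[of "t/2"] sin_double[of "t/2"] by auto
    have d: "cos ((t - pi) / 2) = sin (t/2)" "sin ((t - pi) / 2) = - cos (t/2)"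
      by (simp_all add: diff_divide_distrib cos_diff sin_diff)
    show ?thesis
      unfolding cis_conv_exp[symmetric]
      by (rule complex_eqI) (simp_all add: d c power2_eq_square)
  qed
  moreover have "sin (t/2) > 0" using assms by (intro sin_gt_zero) auto
  ultimately have "Ln (1 - cis t) = of_real (ln (2 * sin (t/2))) + \<i> * of_real ((t - pi) / 2)"
    using assms pi_gt_zero by (intro Ln_unique) (auto simp: exp_add exp_of_real)
  thus ?thesis by simp
qed

lemma summable_one_over_squares: "summable (\<lambda>n. 1 / (real n)\<^sup>2)"
  using inverse_power_summable[of 2, where 'a=real] by (simp add: field_simps)

text \<open>The majorant 1/n^2 works up to and including r = 1, so the damped series tends to the
  undamped one as r -> 1.\<close>

lemma cos_series_abel_continuous:
  "continuous_on ({0..1} \<times> UNIV) (\<lambda>(r,t). \<Sum>n. r ^ n * cos (real n * t) / (real n)\<^sup>2)"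
proof -
  have "uniform_limit ({0..1} \<times> UNIV) (\<lambda>n x. \<Sum>i<n. fst x ^ i * cos (real i * snd x) / (real i)\<^sup>2)
          (\<lambda>x. \<Sum>i. fst x ^ i * cos (real i * snd x) / (real i)\<^sup>2) sequentially"
  proof (rule Weierstrass_m_test[OF _ summable_one_over_squares])
    fix n and x :: "real \<times> real" assume "x \<in> {0..1} \<times> UNIV"
    hence "\<bar>fst x ^ n\<bar> \<le> 1" by (auto simp: power_le_one power_abs)
    hence "\<bar>fst x ^ n\<bar> * \<bar>cos (real n * snd x)\<bar> \<le> 1 * 1" by (intro mult_mono) auto
    thus "norm (fst x ^ n * cos (real n * snd x) / (real n)\<^sup>2) \<le> 1 / (real n)\<^sup>2"
      by (simp add: abs_mult divide_right_mono)
  qed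
  hence "continuous_on ({0..1} \<times> UNIV) (\<lambda>x. \<Sum>i. fst x ^ i * cos (real i * snd x) / (real i)\<^sup>2)"
    by (rule uniform_limit_theorem[rotated]) (auto intro!: always_eventually continuous_intros simp: divide_inverse)
  thus ?thesis by (simp add: case_prod_beta')
qed

text \<open>Follows from uniform continuity on the compact rectangle
  \<open>{0..1} \<times> {a..b}\<close>; the value at r = 1 is \<open>Im_Ln_one_minus_cis\<close>.
  The interval stays away from 0 and 2 pi, where the logarithm is singular at r = 1.\<close>

lemma Im_Ln_abel_uniform:
  assumes ab: "0 < a" "b < 2 * pi" and e: "0 < e"
  shows "\<exists>d>0. \<forall>r t. 1 - d < r \<and> 0 \<le> r \<and> r \<le> 1 \<and> a \<le> t \<and> t \<le> b \<longrightarrow>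
           \<bar>Im (Ln (1 - of_real r * cis t)) - (t - pi) / 2\<bar> < e"
proof -
  \<comment> \<open>Strictly inside the period \<open>cos t < 1\<close>, so the real part
    \<open>1 - r * cos t\<close> is positive and the branch cut is avoided.\<close>
  have notR: "1 - of_real r * cis t \<notin> \<real>\<^sub>\<le>\<^sub>0" if "r \<in> {0..1}" "t \<in> {a..b}" for r t
  proof -
    have "cos t < 1"
    proof (rule ccontr)
      assume "\<not> cos t < 1"
      hence "cos t = 1" using cos_le_one[of t] by linarith
      then obtain n :: int where n: "t = of_int n * 2 * pi" by (auto simp: cos_one_2pi_int)
      have t: "0 < t" "t < 2 * pi" using that ab by auto
      have "0 < real_of_int n" using t(1) n by (simp add: zero_less_mult_iff)
      moreover have "real_of_int n < 1"
      proof (rule ccontr)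
        assume "\<not> real_of_int n < 1"
        hence "1 * (2 * pi) \<le> real_of_int n * (2 * pi)" by (intro mult_right_mono) auto
        thus False using t(2) n by simp
      qed
      ultimately have "0 < n" "n < 1" by linarith+
      thus False by simp
    qed
    hence "r * cos t < 1" using that
      by (smt (verit) atLeastAtMost_iff mult_left_le_one_le mult_nonneg_nonpos)
    thus ?thesis by (auto simp: complex_nonpos_Reals_iff)
  qed
  have "continuous_on ({0..1} \<times> {a..b}) (\<lambda>x. Im (Ln (1 - of_real (fst x) * cis (snd x))))"
    using notR by (intro continuous_intros) auto
  hence "uniformly_continuous_on ({0..1} \<times> {a..b}) (\<lambda>x. Im (Ln (1 - of_real (fst x) * cis (snd x))))"
    by (rule compact_uniformly_continuous) (auto intro: compact_Times)
  then obtain d where d: "d > 0" and dd: "\<And>x y. x \<in> {0..1} \<times> {a..b} \<Longrightarrow> y \<in> {0..1} \<times> {a..b} \<Longrightarrow> dist y x < d \<Longrightarrow>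
     dist (Im (Ln (1 - of_real (fst y) * cis (snd y)))) (Im (Ln (1 - of_real (fst x) * cis (snd x)))) < e"
    using e unfolding uniformly_continuous_on_def by metis
  show ?thesis
  proof (intro exI[of _ d] conjI d allI impI)
    fix r t assume h: "1 - d < r \<and> 0 \<le> r \<and> r \<le> 1 \<and> a \<le> t \<and> t \<le> b"
    have "dist (r, t) (1, t) < d" using h by (simp add: dist_Pair_Pair dist_real_def)
    from dd[OF _ _ this] h have "dist (Im (Ln (1 - of_real r * cis t))) (Im (Ln (1 - cis t))) < e" by simp
    thus "\<bar>Im (Ln (1 - of_real r * cis t)) - (t - pi) / 2\<bar> < e"
      using Im_Ln_one_minus_cis[of t] h ab by (simp add: dist_real_def)
  qed
qed

text \<open>By \<open>Im_Ln_abel_uniform\<close> the damped difference has a derivative that tends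
  to 0 uniformly between s and t as r -> 1; the mean value inequality then forces the limits at s
  and t to agree.\<close>

lemma cos_over_squares_minus_quadratic_const:
  assumes "0 < s" "s < 2 * pi" "0 < t" "t < 2 * pi"
  shows "(\<Sum>n. cos (real n * t) / (real n)\<^sup>2) - (t - pi)\<^sup>2 / 4 = (\<Sum>n. cos (real n * s) / (real n)\<^sup>2) - (s - pi)\<^sup>2 / 4"
proof -
  define G where "G = (\<lambda>r t. (\<Sum>n. r ^ n * cos (real n * t) / (real n)\<^sup>2))"
  define D where "D = (\<lambda>r. (G r t - (t - pi)\<^sup>2 / 4) - (G r s - (s - pi)\<^sup>2 / 4))"
  let ?F = "at_left (1::real)"
  have ev01: "\<forall>\<^sub>F r in ?F. r \<in> {0<..<1}"
    by (rule eventually_at_left_real) simp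
  have Glim: "((\<lambda>r. G r u) \<longlongrightarrow> G 1 u) ?F" for u
  proof -
    have "continuous_on {0..1} ((\<lambda>(r,t). \<Sum>n. r ^ n * cos (real n * t) / (real n)\<^sup>2) \<circ> (\<lambda>r. (r, u)))"
      by (rule continuous_on_compose) (auto intro!: continuous_intros continuous_on_subset[OF cos_series_abel_continuous])
    hence "continuous_on {0..1} (\<lambda>r. G r u)" by (simp add: G_def o_def)
    hence "((\<lambda>r. G r u) \<longlongrightarrow> G 1 u) (at 1 within {0..1})" by (simp add: continuous_on)
    thus ?thesis by (simp add: at_within_Icc_at_left)
  qed
  have lim1: "(D \<longlongrightarrow> D 1) ?F" unfolding D_def by (intro tendsto_intros Glim)
  have lim0: "(D \<longlongrightarrow> 0) ?F"
  proof (rule tendstoI)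
    fix e :: real assume e: "e > 0"
    define a where "a = min s t" define b where "b = max s t"
    have ab: "0 < a" "b < 2 * pi" using assms by (auto simp: a_def b_def)
    define e' where "e' = e / (2 * pi)"
    have e': "e' > 0" using e by (simp add: e'_def)
    obtain d where d: "d > 0" "\<And>r u. 1 - d < r \<Longrightarrow> 0 \<le> r \<Longrightarrow> r \<le> 1 \<Longrightarrow> a \<le> u \<Longrightarrow> u \<le> b \<Longrightarrow>
           \<bar>Im (Ln (1 - of_real r * cis u)) - (u - pi) / 2\<bar> < e'"
      using Im_Ln_abel_uniform[OF ab e'] by metis
    have "\<forall>\<^sub>F r in ?F. r \<in> {1 - d<..<1}"
      by (rule eventually_at_left_real) (use d in simp)
    with ev01 show "\<forall>\<^sub>F r in ?F. dist (D r) 0 < e"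
    proof eventually_elim
      case (elim r)
      have "norm ((\<lambda>u. G r u - (u - pi)\<^sup>2 / 4) t - (\<lambda>u. G r u - (u - pi)\<^sup>2 / 4) s) \<le> e' * norm (t - s)"
      proof (rule field_differentiable_bound[where S="{a..b}" and f'="\<lambda>u. Im (Ln (1 - of_real r * cis u)) - (u - pi) / 2"])
        fix u assume "u \<in> {a..b}"
        show "((\<lambda>u. G r u - (u - pi)\<^sup>2 / 4) has_field_derivative Im (Ln (1 - of_real r * cis u)) - (u - pi) / 2) (at u within {a..b})"
          unfolding G_def using elim
          by (auto intro!: derivative_eq_intros has_field_derivative_at_within[OF abel_cos_series_derivative])
        show "norm (Im (Ln (1 - of_real r * cis u)) - (u - pi) / 2) \<le> e'"
          using d(2)[of r u] elim \<open>u \<in> {a..b}\<close> by simp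
      qed (auto simp: a_def b_def)
      also have "\<dots> < e' * (2 * pi)" using e' assms by (intro mult_strict_left_mono) auto
      finally show ?case using e by (simp add: D_def e'_def)
    qed
  qed
  have "D 1 = 0" by (rule tendsto_unique[OF _ lim1 lim0]) simp
  thus ?thesis by (simp add: D_def G_def)
qed

text \<open>Continuity carries the quadratic formula to the endpoints 0 and 2 pi, evenness to
  negative arguments. The additive constant stays unevaluated because it cancels in the second
  difference used for the tent.\<close>

lemma cos_over_squares_sums:
  assumes "\<bar>t\<bar> \<le> 2 * pi"
  shows "(\<lambda>n. cos (real n * t) / (real n)\<^sup>2) sums
           ((\<Sum>n. cos (real n * pi) / (real n)\<^sup>2) + (\<bar>t\<bar> - pi)\<^sup>2 / 4)"
proof -
  define B where "B = (\<lambda>t::real. \<Sum>n. cos (real n * t) / (real n)\<^sup>2)"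
  have sm: "(\<lambda>n. cos (real n * t) / (real n)\<^sup>2) sums B t" for t
    unfolding B_def
    by (intro summable_sums summable_comparison_test'[OF summable_one_over_squares, where N=0])
       (simp add: divide_right_mono)
  have "continuous_on UNIV ((\<lambda>(r,t). \<Sum>n. r ^ n * cos (real n * t) / (real n)\<^sup>2) \<circ> (\<lambda>t. (1, t)))"
    by (rule continuous_on_compose) (auto intro!: continuous_intros continuous_on_subset[OF cos_series_abel_continuous])
  hence "continuous_on UNIV B" by (simp add: B_def o_def)
  hence cB: "continuous_on S B" for S by (rule continuous_on_subset) simp
  have "B u - (u - pi)\<^sup>2 / 4 = B pi" if "u \<in> {0..2*pi}" for u
  proof (rule continuous_constant_on_closure[of "{0<..<2*pi}" "\<lambda>u. B u - (u - pi)\<^sup>2 / 4"])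
    show "continuous_on (closure {0<..<2 * pi}) (\<lambda>u. B u - (u - pi)\<^sup>2 / 4)"
      by (intro continuous_intros cB) auto
    show "u \<in> closure {0<..<2 * pi}" using that by simp
    show "B x - (x - pi)\<^sup>2 / 4 = B pi" if "x \<in> {0<..<2 * pi}" for x
      using cos_over_squares_minus_quadratic_const[of pi x] that by (simp add: B_def)
  qed
  from this[of "\<bar>t\<bar>"] have "B \<bar>t\<bar> = B pi + (\<bar>t\<bar> - pi)\<^sup>2 / 4" using assms by simp
  moreover have "B \<bar>t\<bar> = B t" by (cases "t \<ge> 0") (simp_all add: B_def)
  ultimately show ?thesis using sm[of t] by (simp add: B_def)
qed

text \<open>Up to a factor and its mean, the tent is the second difference with step
  \<open>h\<close> of the quadratic in \<open>cos_over_squares_sums\<close>; on cosines this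
  difference is multiplication by \<open>2 * (1 - cos (real n * h))\<close>, whence nonnegative
  coefficients. The range of \<open>s\<close> keeps \<open>s + h\<close> and \<open>s - h\<close>
  within [-2 pi, 2 pi].\<close>

lemma tent_cos_series:
  fixes h s :: real
  assumes h: "0 < h" and s: "\<bar>s\<bar> \<le> 2 * pi - h"
  shows "(\<lambda>n. (if n = 0 then h / (2 * pi) else 2 * (1 - cos (real n * h)) / (pi * h * (real n)\<^sup>2)) * cos (real n * s))
           sums max 0 (1 - \<bar>s\<bar> / h)"
proof -
  define K where "K = (\<Sum>n. cos (real n * pi) / (real n)\<^sup>2)"
  define c where "c = (\<lambda>t n. cos (real n * t) / (real n)\<^sup>2)"
  have S: "c t sums (K + (\<bar>t\<bar> - pi)\<^sup>2 / 4)" if "\<bar>t\<bar> \<le> 2 * pi" for t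
    unfolding c_def K_def by (rule cos_over_squares_sums[OF that])
  have "(\<lambda>n. 2 * c s n - c (s + h) n - c (s - h) n) sums
      (2 * (K + (\<bar>s\<bar> - pi)\<^sup>2 / 4) - (K + (\<bar>s + h\<bar> - pi)\<^sup>2 / 4) - (K + (\<bar>s - h\<bar> - pi)\<^sup>2 / 4))"
    using h s by (intro sums_diff sums_mult S) auto
  hence "(\<lambda>n. (2 * c s n - c (s + h) n - c (s - h) n) / (pi * h)) sums
      ((2 * (K + (\<bar>s\<bar> - pi)\<^sup>2 / 4) - (K + (\<bar>s + h\<bar> - pi)\<^sup>2 / 4) - (K + (\<bar>s - h\<bar> - pi)\<^sup>2 / 4)) / (pi * h))"
    by (rule sums_divide)
  also have "(2 * (K + (\<bar>s\<bar> - pi)\<^sup>2 / 4) - (K + (\<bar>s + h\<bar> - pi)\<^sup>2 / 4) - (K + (\<bar>s - h\<bar> - pi)\<^sup>2 / 4)) / (pi * h)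
      = max 0 (1 - \<bar>s\<bar> / h) - h / (2 * pi)"
  proof -
    have "2 * (K + (\<bar>s\<bar> - pi)\<^sup>2 / 4) - (K + (\<bar>s + h\<bar> - pi)\<^sup>2 / 4) - (K + (\<bar>s - h\<bar> - pi)\<^sup>2 / 4)
       = pi * max 0 (h - \<bar>s\<bar>) - h\<^sup>2 / 2"
      using h by (cases "s \<ge> 0"; cases "\<bar>s\<bar> \<le> h"; auto simp: abs_if max_def power2_eq_square field_simps)
    moreover have "max 0 (1 - \<bar>s\<bar> / h) = max 0 (h - \<bar>s\<bar>) / h"
      using h by (auto simp: max_def field_simps)
    ultimately show ?thesis using h pi_gt_zero by (simp add: field_simps power2_eq_square)
  qed
  finally have T: "(\<lambda>n. (2 * c s n - c (s + h) n - c (s - h) n) / (pi * h)) sums (max 0 (1 - \<bar>s\<bar> / h) - h / (2 * pi))" .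
  \<comment> \<open>\<open>c s 0\<close> is 0 because division by zero yields 0, so the mean
    \<open>h / (2 * pi)\<close> enters as a separate term at n = 0.\<close>
  have "(\<lambda>n. if n = (0::nat) then h / (2 * pi) else 0) sums (h / (2 * pi))"
    using sums_single[of 0 "\<lambda>_. h / (2 * pi)"] by simp
  from sums_add[OF T this]
  have "(\<lambda>n. (2 * c s n - c (s + h) n - c (s - h) n) / (pi * h) + (if n = 0 then h / (2 * pi) else 0)) sums max 0 (1 - \<bar>s\<bar> / h)"
    by simp
  also have "(\<lambda>n. (2 * c s n - c (s + h) n - c (s - h) n) / (pi * h) + (if n = 0 then h / (2 * pi) else 0)) =
      (\<lambda>n. (if n = 0 then h / (2 * pi) else 2 * (1 - cos (real n * h)) / (pi * h * (real n)\<^sup>2)) * cos (real n * s))"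
    using h by (auto simp: fun_eq_iff c_def ring_distribs cos_add cos_diff field_simps)
  finally show ?thesis .
qed

section \<open>Approximation of the tent by convex combinations of characters\<close>

definition tent :: "real \<Rightarrow> real \<Rightarrow> real" where
  "tent h s = max 0 (1 - \<bar>s\<bar> / h)"

lemma sum_symmetric_int:
  fixes f :: "int \<Rightarrow> 'a::comm_monoid_add"
  shows "(\<Sum>k\<in>{- int N<..<int N}. f k) = (\<Sum>n<N. if n = 0 then f 0 else f (int n) + f (- int n))"
proof (induction N)
  case (Suc N)
  show ?case
  proof (cases "N = 0")
    case True
    have "{- 1<..<1::int} = {0}" by auto
    thus ?thesis using True by simp
  next
    case False
    have "{- int (Suc N)<..<int (Suc N)} = insert (int N) (insert (- int N) {- int N<..<int N})"
      by auto
    thus ?thesis using False Suc by (simp add: ac_simps)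
  qed
qed simp

text \<open>Truncating the cosine series loses a mass \<open>r\<close>; putting it back at frequency
  0 makes the weights sum to exactly 1, as Jensen's inequality requires later, at the price of a
  total error of at most \<open>2 * r\<close>.\<close>

lemma tent_trig_approx:
  assumes h: "0 < h" "h \<le> 2 * pi" and e: "0 < e"
  obtains I :: "int set" and a :: "int \<Rightarrow> real" where
    "finite I" "\<And>k. k \<in> I \<Longrightarrow> 0 \<le> a k" "sum a I = 1"
    "\<And>s. \<bar>s\<bar> \<le> 2 * pi - h \<Longrightarrow>
       norm (of_real (tent h s) - (\<Sum>k\<in>I. of_real (a k) * cis (of_int k * s))) \<le> e"
proof -
  define b where "b = (\<lambda>n. if n = 0 then h / (2 * pi) else 2 * (1 - cos (real n * h)) / (pi * h * (real n)\<^sup>2))"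
  have S: "(\<lambda>n. b n * cos (real n * s)) sums tent h s" if "\<bar>s\<bar> \<le> 2 * pi - h" for s
    using tent_cos_series[OF h(1) that] by (simp add: b_def tent_def)
  have b0: "b n \<ge> 0" for n using h by (simp add: b_def)
  \<comment> \<open>Evaluation at s = 0, the peak of the tent, gives the total mass of the
    coefficients.\<close>
  have S1: "b sums 1" using S[of 0] h by (simp add: tent_def)
  obtain M where M: "\<And>n. n \<ge> M \<Longrightarrow> norm ((\<Sum>i<n. b i) - 1) < e / 2"
    using S1 e unfolding sums_def LIMSEQ_iff by (meson half_gt_zero)
  \<comment> \<open>\<open>Suc\<close> makes \<open>N\<close> positive, so that 0 belongs to the
    index set \<open>I\<close> below.\<close>
  define N where "N = Suc M"
  define r where "r = 1 - (\<Sum>i<N. b i)"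
  have r0: "r \<ge> 0" using sum_le_suminf[of b "{..<N}"] S1 b0 by (simp add: r_def sums_iff)
  have re: "r < e / 2"
  proof -
    have "N \<ge> M" by (simp add: N_def)
    from M[OF this] show ?thesis unfolding r_def real_norm_def by linarith
  qed
  \<comment> \<open>Since the coefficients are nonnegative, the tail at any \<open>s\<close> is
    dominated by the tail at 0, which is \<open>r\<close>.\<close>
  have tl: "\<bar>tent h s - (\<Sum>n<N. b n * cos (real n * s))\<bar> \<le> r" if s: "\<bar>s\<bar> \<le> 2 * pi - h" for s
  proof -
    have 1: "(\<lambda>n. b (n + N) * cos (real (n + N) * s)) sums (tent h s - (\<Sum>n<N. b n * cos (real n * s)))"
      using sums_split_initial_segment[OF S[OF s]] .
    have 2: "(\<lambda>n. b (n + N)) sums r"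
      using sums_split_initial_segment[OF S1] by (simp add: r_def)
    have 3: "\<bar>b (n + N) * cos (real (n + N) * s)\<bar> \<le> b (n + N)" for n
      using b0[of "n + N"] by (simp add: abs_mult mult_left_le)
    have "tent h s - (\<Sum>n<N. b n * cos (real n * s)) \<le> r"
      by (rule sums_le[OF _ 1 2]) (use 3 in \<open>auto simp: abs_le_iff\<close>)
    moreover have "- r \<le> tent h s - (\<Sum>n<N. b n * cos (real n * s))"
      by (rule sums_le[OF _ sums_minus[OF 2] 1]) (use 3 in \<open>smt (verit)\<close>)
    ultimately show ?thesis by (simp add: abs_le_iff)
  qed
  define I where "I = {- int N<..<int N}"
  \<comment> \<open>Each cosine is split evenly between the frequencies n and -n.\<close>
  define a0 where "a0 = (\<lambda>k::int. if k = 0 then b 0 else b (nat \<bar>k\<bar>) / 2)"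
  define a where "a = (\<lambda>k::int. a0 k + (if k = 0 then r else 0))"
  have I0: "finite I" "0 \<in> I" by (auto simp: I_def N_def)
  have "sum a0 I = (\<Sum>n<N. b n)"
    unfolding I_def sum_symmetric_int by (intro sum.cong) (auto simp: a0_def)
  hence "sum a I = 1" using I0 by (simp add: a_def sum.distrib r_def)
  moreover have "norm (of_real (tent h s) - (\<Sum>k\<in>I. of_real (a k) * cis (of_int k * s))) \<le> e"
    if s: "\<bar>s\<bar> \<le> 2 * pi - h" for s
  proof -
    have "(\<Sum>k\<in>I. of_real (a k) * cis (of_int k * s))
       = (\<Sum>k\<in>I. of_real (a0 k) * cis (of_int k * s)) + (\<Sum>k\<in>I. if k = 0 then of_real r else 0)"
      unfolding sum.distrib[symmetric] by (intro sum.cong) (auto simp: a_def)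
    also have "(\<Sum>k\<in>I. of_real (a0 k) * cis (of_int k * s)) = of_real (\<Sum>n<N. b n * cos (real n * s))"
      unfolding I_def sum_symmetric_int of_real_sum
      by (intro sum.cong refl) (auto simp: a0_def complex_eq_iff)
    finally have "of_real (tent h s) - (\<Sum>k\<in>I. of_real (a k) * cis (of_int k * s)) =
       of_real (tent h s - (\<Sum>n<N. b n * cos (real n * s)) - r)" using I0 by simp
    also have "norm \<dots> \<le> e" unfolding norm_of_real using tl[OF s] re r0 by linarith
    finally show ?thesis .
  qed
  moreover have "a k \<ge> 0" for k using b0 r0 by (simp add: a_def a0_def)
  ultimately show ?thesis using I0 that by blast
qed

subsection \<open>Localised Fourier coefficients\<close>

definition tent_prod :: "real \<Rightarrow> real^'n \<Rightarrow> real^'n \<Rightarrow> real" where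
  "tent_prod h t0 t = (\<Prod>j\<in>UNIV. tent h (t $ j - t0 $ j))"

lemma tent_bounds: "0 < h \<Longrightarrow> 0 \<le> tent h s" "0 < h \<Longrightarrow> tent h s \<le> 1"
  by (auto simp: tent_def)

lemma prod_sum_vec:
  fixes f :: "'n::finite \<Rightarrow> int \<Rightarrow> 'c::comm_semiring_1"
  assumes "finite I"
  shows "(\<Prod>j\<in>UNIV. \<Sum>k\<in>I. f j k) = (\<Sum>k | \<forall>j. k $ j \<in> I. \<Prod>j\<in>UNIV. f j (k $ j))"
proof -
  have "(\<Prod>j\<in>UNIV. \<Sum>k\<in>I. f j k) = (\<Sum>g\<in>PiE UNIV (\<lambda>_. I). \<Prod>j\<in>UNIV. f j (g j))"
    by (rule prod_sum_PiE) (use assms in auto)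
  also have "\<dots> = (\<Sum>k | \<forall>j. k $ j \<in> I. \<Prod>j\<in>UNIV. f j (k $ j))"
    by (rule sum.reindex_bij_witness[of _ vec_nth vec_lambda]) (auto simp: PiE_iff)
  finally show ?thesis .
qed

lemma finite_vec_box: "finite I \<Longrightarrow> finite {k :: 'a ^ 'n::finite. \<forall>j. k $ j \<in> I}"
proof -
  assume "finite I"
  hence "finite (PiE (UNIV :: 'n set) (\<lambda>_. I))" by (intro finite_PiE) auto
  hence "finite (vec_lambda ` PiE (UNIV :: 'n set) (\<lambda>_. I))" by (rule finite_imageI)
  moreover have "{k :: 'a ^ 'n. \<forall>j. k $ j \<in> I} \<subseteq> vec_lambda ` PiE (UNIV :: 'n set) (\<lambda>_. I)"
    by (auto simp: image_iff PiE_iff intro!: bexI[of _ "vec_nth _"])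
  ultimately show ?thesis by (rule finite_subset[rotated])
qed

lemma cis_sum: "finite A \<Longrightarrow> cis (sum f A) = (\<Prod>j\<in>A. cis (f j))"
  by (induction A rule: finite_induct) (simp_all flip: cis_mult)

lemma int_inner_diff_left: "int_inner (k - l) t = int_inner k t - int_inner l t"
  by (simp add: int_inner_def algebra_simps sum_subtractf)

lemma int_inner_diff_right: "int_inner k (t - s) = int_inner k t - int_inner k s"
  by (simp add: int_inner_def algebra_simps sum_subtractf)

lemma continuous_on_int_inner [continuous_intros]: "continuous_on S (int_inner k)"
  unfolding int_inner_def by (intro continuous_intros)

lemma mem_torus_cube:
  fixes t :: "real^'n"
  shows "t \<in> torus_cube \<longleftrightarrow> (\<forall>j. 0 \<le> t $ j \<and> t $ j \<le> 2 * pi)"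
proof -
  have "(One :: real^'n) $ j = 1" for j
    by (simp add: cart_eq_inner_axis[of _ j] axis_in_Basis_iff)
  thus ?thesis by (simp add: torus_cube_def mem_box_cart del: sum_component)
qed

lemma absolutely_integrable_mult_continuous:
  fixes F g :: "real^'n \<Rightarrow> complex"
  assumes F: "F absolutely_integrable_on torus_cube" and g: "continuous_on torus_cube g"
  shows "(\<lambda>t. F t * g t) absolutely_integrable_on torus_cube"
proof -
  have c: "compact (torus_cube :: (real^'n) set)" by (simp add: torus_cube_def)
  have "(\<lambda>t. g t * F t) absolutely_integrable_on torus_cube"
  proof (rule absolutely_integrable_bounded_measurable_product[OF bilinear_times _ _ _ F])
    show "g \<in> borel_measurable (lebesgue_on torus_cube)"
      using g c by (intro continuous_imp_measurable_on_sets_lebesgue) (auto simp: torus_cube_def)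
    show "bounded (g ` torus_cube)"
      using compact_continuous_image[OF g c] by (rule compact_imp_bounded)
  qed (auto simp: torus_cube_def)
  thus ?thesis by (simp add: mult.commute)
qed

lemma integral_cis_fourier_coeff:
  fixes F :: "real^'n \<Rightarrow> complex"
  shows "integral torus_cube (\<lambda>t. F t * cis (- int_inner k t)) = of_real ((2 * pi) ^ CARD('n)) * fourier_coeff F k"
proof -
  have "(2 * pi) powr (- real CARD('n)) = inverse ((2 * pi) ^ CARD('n))"
    using powr_realpow[of "2 * pi" "CARD('n)"] pi_gt_zero by (simp add: powr_minus)
  moreover have "complex_of_real ((2 * pi) ^ CARD('n)) * complex_of_real (inverse ((2 * pi) ^ CARD('n))) = 1"
    unfolding of_real_mult[symmetric] using pi_gt_zero by (subst right_inverse) auto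
  ultimately show ?thesis unfolding fourier_coeff_def by (simp only: mult.assoc[symmetric] mult_1_left)
qed

text \<open>With each tent replaced by its trigonometric polynomial, the integral becomes a weighted
  sum of shifted Fourier coefficients. The centre \<open>t0\<close> enters only through unimodular
  factors, so the bound is the same convolution for every centre; the last term is the approximation
  error.\<close>

lemma fourier_localized_bound:
  fixes F :: "real^'n \<Rightarrow> complex"
  assumes h: "0 < h"
    and I: "finite I" "\<And>k. k \<in> I \<Longrightarrow> 0 \<le> a k" "sum a I = 1"
    and apx: "\<And>s. \<bar>s\<bar> \<le> 2 * pi - h \<Longrightarrow>
       norm (of_real (tent h s) - (\<Sum>k\<in>I. of_real (a k) * cis (of_int k * s))) \<le> e"
    and F: "F absolutely_integrable_on torus_cube"
    and t0: "\<And>j. h \<le> t0 $ j" "\<And>j. t0 $ j \<le> 2 * pi - h"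
  shows "norm (integral torus_cube (\<lambda>t. F t * (of_real (tent_prod h t0 t) * cis (- int_inner k0 t))))
     \<le> (2 * pi) ^ CARD('n) * (\<Sum>k | \<forall>j. k $ j \<in> I. (\<Prod>j\<in>UNIV. a (k $ j)) * norm (fourier_coeff F (k0 - k)))
        + real CARD('n) * e * integral torus_cube (\<lambda>t. norm (F t))"
proof -
  define Q where "Q = {k :: int^'n. \<forall>j. k $ j \<in> I}"
  define A where "A = (\<lambda>k :: int^'n. \<Prod>j\<in>UNIV. a (k $ j))"
  have finQ: "finite Q" unfolding Q_def by (rule finite_vec_box[OF I(1)])
  have A0: "A k \<ge> 0" if "k \<in> Q" for k using that I(2) by (auto simp: A_def Q_def intro!: prod_nonneg)
  define \<tau> where "\<tau> = (\<lambda>s. \<Sum>k\<in>I. complex_of_real (a k) * cis (of_int k * s))"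
  define P where "P = (\<lambda>t. \<Prod>j\<in>UNIV. \<tau> (t $ j - t0 $ j))"
  have P: "P t = (\<Sum>k\<in>Q. of_real (A k) * cis (int_inner k (t - t0)))" for t
    unfolding P_def \<tau>_def Q_def prod_sum_vec[OF I(1)]
    by (intro sum.cong refl) (simp add: A_def int_inner_def cis_sum prod.distrib)
  have contD: "continuous_on torus_cube (\<lambda>t. complex_of_real (tent_prod h t0 t))"
    unfolding tent_prod_def tent_def using h by (intro continuous_intros) auto
  have contP: "continuous_on torus_cube P"
    unfolding P_def \<tau>_def by (intro continuous_intros)
  have contc: "continuous_on torus_cube (\<lambda>t. cis (- int_inner k t))" for k :: "int^'n"
    by (intro continuous_intros)
  have PD: "norm (of_real (tent_prod h t0 t) - P t) \<le> real CARD('n) * e" if t: "t \<in> torus_cube" for t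
  proof -
    \<comment> \<open>Both points lie in the cube and \<open>t0\<close> keeps distance
      \<open>h\<close> from its faces, so the approximation applies without periodising the
      tent.\<close>
    have s: "\<bar>t $ j - t0 $ j\<bar> \<le> 2 * pi - h" for j
    proof -
      have "0 \<le> t $ j" "t $ j \<le> 2 * pi"
        using t by (auto simp: mem_torus_cube)
      thus ?thesis using t0[of j] by (auto simp: abs_le_iff)
    qed
    have "of_real (tent_prod h t0 t) - P t = (\<Prod>j\<in>UNIV. complex_of_real (tent h (t $ j - t0 $ j))) - (\<Prod>j\<in>UNIV. \<tau> (t $ j - t0 $ j))"
      by (simp add: tent_prod_def P_def)
    \<comment> \<open>The difference of products telescopes because all factors have modulus at most
      1; for the polynomials this holds since their nonnegative weights sum to 1.\<close>
    also have "norm \<dots> \<le> (\<Sum>j\<in>UNIV. norm (complex_of_real (tent h (t $ j - t0 $ j)) - \<tau> (t $ j - t0 $ j)))"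
    proof (rule norm_prod_diff)
      show "norm (complex_of_real (tent h (t $ j - t0 $ j))) \<le> 1" for j
        using tent_bounds[OF h] by simp
      have "norm (\<tau> s) \<le> (\<Sum>k\<in>I. norm (complex_of_real (a k) * cis (of_int k * s)))" for s
        unfolding \<tau>_def by (rule norm_sum)
      also have "(\<Sum>k\<in>I. norm (complex_of_real (a k) * cis (of_int k * s))) = sum a I" for s
        using I(2) by (intro sum.cong) (auto simp: norm_mult)
      finally show "norm (\<tau> (t $ j - t0 $ j)) \<le> 1" for j using I(3) by simp
    qed
    also have "\<dots> \<le> (\<Sum>j\<in>(UNIV :: 'n set). e)"
      unfolding \<tau>_def by (intro sum_mono apx s)
    finally show ?thesis by simp
  qed
  have iF: "(\<lambda>t. F t * g t) integrable_on torus_cube" if "continuous_on torus_cube g" for g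
    using absolutely_integrable_mult_continuous[OF F that] by (rule set_lebesgue_integral_eq_integral(1))
  have nF: "(\<lambda>t. norm (F t)) integrable_on torus_cube"
    using F by (simp add: absolutely_integrable_on_def)
  have main: "integral torus_cube (\<lambda>t. F t * (P t * cis (- int_inner k0 t))) =
      (\<Sum>k\<in>Q. of_real (A k) * cis (- int_inner k t0) * (of_real ((2 * pi) ^ CARD('n)) * fourier_coeff F (k0 - k)))"
  proof -
    have "(\<lambda>t. F t * (P t * cis (- int_inner k0 t))) =
       (\<lambda>t. \<Sum>k\<in>Q. of_real (A k) * cis (- int_inner k t0) * (F t * cis (- int_inner (k0 - k) t)))"
      unfolding P
      by (simp add: fun_eq_iff sum_distrib_left sum_distrib_right int_inner_diff_left int_inner_diff_right
            mult.assoc mult.left_commute cis_mult algebra_simps)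
    hence "integral torus_cube (\<lambda>t. F t * (P t * cis (- int_inner k0 t))) =
       (\<Sum>k\<in>Q. integral torus_cube (\<lambda>t. of_real (A k) * cis (- int_inner k t0) * (F t * cis (- int_inner (k0 - k) t))))"
      using integrable_on_mult_right[OF iF[OF contc]] by (simp only: integral_sum[OF finQ])
    thus ?thesis by (simp only: integral_mult_right integral_cis_fourier_coeff)
  qed
  have "norm (integral torus_cube (\<lambda>t. F t * (P t * cis (- int_inner k0 t))))
     \<le> (\<Sum>k\<in>Q. norm (of_real (A k) * cis (- int_inner k t0) * (of_real ((2 * pi) ^ CARD('n)) * fourier_coeff F (k0 - k))))"
    unfolding main by (rule norm_sum)
  also have "\<dots> = (2 * pi) ^ CARD('n) * (\<Sum>k\<in>Q. A k * norm (fourier_coeff F (k0 - k)))"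
    unfolding sum_distrib_left by (intro sum.cong) (auto simp: norm_mult norm_power A0)
  finally have 1: "norm (integral torus_cube (\<lambda>t. F t * (P t * cis (- int_inner k0 t)))) \<le>
      (2 * pi) ^ CARD('n) * (\<Sum>k\<in>Q. A k * norm (fourier_coeff F (k0 - k)))" .
  have i1: "(\<lambda>t. F t * (of_real (tent_prod h t0 t) * cis (- int_inner k0 t))) integrable_on torus_cube"
    by (intro iF continuous_on_mult contD contc)
  have i2: "(\<lambda>t. F t * (P t * cis (- int_inner k0 t))) integrable_on torus_cube"
    by (intro iF continuous_on_mult contP contc)
  have "norm (integral torus_cube (\<lambda>t. F t * (of_real (tent_prod h t0 t) * cis (- int_inner k0 t)) - F t * (P t * cis (- int_inner k0 t))))
      \<le> integral torus_cube (\<lambda>t. real CARD('n) * e * norm (F t))"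
  proof (rule integral_norm_bound_integral)
    show "(\<lambda>t. real CARD('n) * e * norm (F t)) integrable_on torus_cube"
      by (rule integrable_on_mult_right[OF nF])
    fix t :: "real^'n" assume t: "t \<in> torus_cube"
    have "F t * (of_real (tent_prod h t0 t) * cis (- int_inner k0 t)) - F t * (P t * cis (- int_inner k0 t))
      = (of_real (tent_prod h t0 t) - P t) * F t * cis (- int_inner k0 t)" by (simp add: algebra_simps)
    also have "norm \<dots> \<le> real CARD('n) * e * norm (F t)"
      using PD[OF t] by (simp add: norm_mult mult_right_mono)
    finally show "norm (F t * (of_real (tent_prod h t0 t) * cis (- int_inner k0 t)) - F t * (P t * cis (- int_inner k0 t))) \<le> real CARD('n) * e * norm (F t)" .
  qed (intro integrable_diff i1 i2)
  hence "norm (integral torus_cube (\<lambda>t. F t * (of_real (tent_prod h t0 t) * cis (- int_inner k0 t))) - integral torus_cube (\<lambda>t. F t * (P t * cis (- int_inner k0 t))))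
      \<le> real CARD('n) * e * integral torus_cube (\<lambda>t. norm (F t))"
    by (simp add: integral_diff[OF i1 i2])
  with 1 show ?thesis unfolding Q_def A_def
    by (meson norm_triangle_sub add_mono order_trans)
qed

section \<open>From localised coefficients to the l^p norm\<close>

text \<open>When one endpoint is 0 the inequality reduces to c^p <= c for 0 < c < 1; otherwise
  convexity on the positive reals applies.\<close>

lemma convex_on_powr_nonneg:
  assumes "p \<ge> 1" shows "convex_on {0..} (\<lambda>x::real. x powr p)"
proof (rule convex_onI)
  fix t x y :: real assume t: "0 < t" "t < 1" and xy: "x \<in> {0..}" "y \<in> {0..}"
  have small: "(c * z) powr p \<le> c * z powr p" if "0 < c" "c < 1" "0 \<le> z" for c z
  proof -
    have "c powr p \<le> c powr 1" using that assms by (intro powr_mono') auto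
    thus ?thesis using that by (simp add: powr_mult mult_right_mono)
  qed
  show "((1 - t) *\<^sub>R x + t *\<^sub>R y) powr p \<le> (1 - t) * x powr p + t * y powr p"
  proof (cases "x = 0 \<or> y = 0")
    case True
    thus ?thesis using small[of t y] small[of "1 - t" x] t xy assms by auto
  next
    case False
    thus ?thesis using convex_onD[OF powr_convex[OF assms], of t x y] t xy by simp
  qed
qed simp

lemma sum_powr_le:
  assumes "finite S" "\<And>i. i \<in> S \<Longrightarrow> 0 \<le> a i" "sum a S = 1" "\<And>i. i \<in> S \<Longrightarrow> 0 \<le> x i" "p \<ge> (1::real)"
  shows "(\<Sum>i\<in>S. a i * x i) powr p \<le> (\<Sum>i\<in>S. a i * x i powr p)"
proof -
  have "S \<noteq> {}" using assms by auto
  thus ?thesis using convex_on_sum[OF assms(1) _ convex_on_powr_nonneg[OF assms(5)] assms(3), of x] assms by simp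
qed

text \<open>At every \<open>k \<in> K\<close> the average of the shifted moduli with weights
  \<open>A\<close> is at least \<open>z\<close>. Jensen's inequality moves the p-th power inside the
  average, and for each fixed shift the sum over \<open>K\<close> is at most the full l^p sum.
  Interchanging the two sums relies on the weights being the same for all \<open>k\<close>.\<close>

lemma Ap_norm_ge_card:
  fixes F :: "real^'n \<Rightarrow> complex" and K :: "(int^'n) set"
  assumes F: "F \<in> Ap_space p" and p: "1 \<le> p" and h: "0 < h" "h \<le> 2 * pi" and y: "0 < y"
    and K: "finite K"
    and loc: "\<And>k. k \<in> K \<Longrightarrow> \<exists>t0. (\<forall>j. h \<le> t0 $ j \<and> t0 $ j \<le> 2 * pi - h) \<and>
       y \<le> norm (integral torus_cube (\<lambda>t. F t * (of_real (tent_prod h t0 t) * cis (- int_inner k t))))"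
  shows "real (card K) powr (1/p) * (y / (2 * (2 * pi) ^ CARD('n))) \<le> Ap_norm p F"
proof -
  define m where "m = integral torus_cube (\<lambda>t. norm (F t))"
  have m0: "m \<ge> 0" unfolding m_def by (rule Henstock_Kurzweil_Integration.integral_nonneg)
     (use F in \<open>auto simp: Ap_space_def absolutely_integrable_on_def\<close>)
  \<comment> \<open>The tolerance is tuned to the L^1 norm \<open>m\<close> of \<open>F\<close> so
    that the approximation error is at most \<open>y / 2\<close>; the summand 1 avoids division by
    zero. The final bound does not involve \<open>e\<close>.\<close>
  define e where "e = y / (2 * (real CARD('n) * m + 1))"
  have nm: "real CARD('n) * m + 1 > 0" using m0 by (simp add: add_nonneg_pos)
  have e0: "e > 0" using y nm by (simp add: e_def)
  have "e * (real CARD('n) * m) \<le> e * (real CARD('n) * m + 1)" using e0 by (intro mult_left_mono) auto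
  also have "\<dots> = y / 2" using nm unfolding e_def by (metis divide_divide_eq_left nonzero_eq_divide_eq order_less_irrefl)
  finally have em: "real CARD('n) * e * m \<le> y / 2" by (simp add: mult_ac)
  obtain I a where Ia: "finite I" "\<And>k. k \<in> I \<Longrightarrow> 0 \<le> a k" "sum a I = 1"
    and apx: "\<And>s. \<bar>s\<bar> \<le> 2 * pi - h \<Longrightarrow>
       norm (of_real (tent h s) - (\<Sum>k\<in>I. of_real (a k) * cis (of_int k * s))) \<le> e"
    using tent_trig_approx[OF h e0] by blast
  define Q where "Q = {k :: int^'n. \<forall>j. k $ j \<in> I}"
  define A where "A = (\<lambda>k :: int^'n. \<Prod>j\<in>UNIV. a (k $ j))"
  define b where "b = (\<lambda>k. norm (fourier_coeff F k))"
  define z where "z = y / (2 * (2 * pi) ^ CARD('n))"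
  define S where "S = infsum (\<lambda>k. b k powr p) UNIV"
  have finQ: "finite Q" unfolding Q_def by (rule finite_vec_box[OF Ia(1)])
  have A0: "A k \<ge> 0" if "k \<in> Q" for k using that Ia(2) by (auto simp: A_def Q_def intro!: prod_nonneg)
  have A1: "sum A Q = 1"
    using prod_sum_vec[OF Ia(1), of "\<lambda>_ :: 'n. a"] Ia(3) by (simp add: A_def Q_def)
  have z0: "z > 0" using y by (simp add: z_def)
  have zk: "z \<le> (\<Sum>q\<in>Q. A q * b (k - q))" if k: "k \<in> K" for k
  proof -
    obtain t0 where t0: "\<And>j. h \<le> t0 $ j" "\<And>j. t0 $ j \<le> 2 * pi - h"
      "y \<le> norm (integral torus_cube (\<lambda>t. F t * (of_real (tent_prod h t0 t) * cis (- int_inner k t))))"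
      using loc[OF k] by blast
    have Fi: "F absolutely_integrable_on torus_cube" using F by (simp add: Ap_space_def)
    have "y \<le> (2 * pi) ^ CARD('n) * (\<Sum>q\<in>Q. A q * b (k - q)) + real CARD('n) * e * m"
      using fourier_localized_bound[OF h(1) Ia apx Fi t0(1,2), of k] t0(3)
      unfolding Q_def A_def b_def m_def by linarith
    hence "y / 2 \<le> (2 * pi) ^ CARD('n) * (\<Sum>q\<in>Q. A q * b (k - q))" using em by linarith
    thus ?thesis unfolding z_def by (simp add: field_simps)
  qed
  have sub: "(\<Sum>k\<in>K. b (k - q) powr p) \<le> S" for q
  proof -
    have "(\<Sum>k\<in>K. b (k - q) powr p) = (\<Sum>k\<in>(\<lambda>k. k - q) ` K. b k powr p)"
      by (subst sum.reindex) (auto simp: inj_on_def)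
    also have "\<dots> \<le> S" unfolding S_def b_def
      by (rule finite_sum_le_infsum) (use F K in \<open>auto simp: Ap_space_def\<close>)
    finally show ?thesis .
  qed
  have "real (card K) * z powr p = (\<Sum>k\<in>K. z powr p)" by simp
  also have "\<dots> \<le> (\<Sum>k\<in>K. (\<Sum>q\<in>Q. A q * b (k - q)) powr p)"
    using zk z0 p by (intro sum_mono powr_mono2) auto
  also have "\<dots> \<le> (\<Sum>k\<in>K. \<Sum>q\<in>Q. A q * b (k - q) powr p)"
    by (intro sum_mono sum_powr_le finQ A0 A1 p) (auto simp: b_def)
  also have "\<dots> = (\<Sum>q\<in>Q. A q * (\<Sum>k\<in>K. b (k - q) powr p))"
    by (subst sum.swap) (simp add: sum_distrib_left)
  also have "\<dots> \<le> (\<Sum>q\<in>Q. A q * S)"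
    by (intro sum_mono mult_left_mono sub A0)
  also have "\<dots> = S" using A1 by (simp flip: sum_distrib_right)
  finally have "(real (card K) * z powr p) powr (1/p) \<le> S powr (1/p)"
    using p by (intro powr_mono2) auto
  also have "(real (card K) * z powr p) powr (1/p) = real (card K) powr (1/p) * z"
    using p z0 by (simp add: powr_mult powr_powr)
  finally show ?thesis by (simp add: z_def S_def b_def Ap_norm_def)
qed

section \<open>First-order approximation of the phase\<close>

lemma partial_deriv_along_axis:
  assumes "(\<lambda>s. \<phi> ((x + u *\<^sub>R axis i 1) + s *\<^sub>R axis i 1)) differentiable (at 0)"
  shows "((\<lambda>s. \<phi> (x + s *\<^sub>R axis i 1)) has_real_derivative partial_deriv \<phi> i (x + u *\<^sub>R axis i 1)) (at u)"
proof -
  have "((\<lambda>s. \<phi> ((x + u *\<^sub>R axis i 1) + s *\<^sub>R axis i 1)) has_real_derivative partial_deriv \<phi> i (x + u *\<^sub>R axis i 1)) (at 0)"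
    using assms unfolding partial_deriv_def
    by (metis DERIV_deriv_iff_real_differentiable)
  hence "((\<lambda>s. \<phi> (x + (u + s) *\<^sub>R axis i 1)) has_real_derivative partial_deriv \<phi> i (x + u *\<^sub>R axis i 1)) (at 0)"
    by (simp add: algebra_simps)
  thus ?thesis using DERIV_shift[of "\<lambda>s. \<phi> (x + s *\<^sub>R axis i 1)" _ 0 u] by (simp add: add.commute)
qed

text \<open>The path from \<open>t0\<close> to \<open>t\<close> changes one coordinate at a time,
  with the mean value inequality on each axis-parallel segment. The intermediate points stay in the
  box, so control of the partial derivatives suffices and each step costs at most
  \<open>B * h\<close>.\<close>

lemma first_order_approx_box:
  fixes \<phi> :: "real^'n \<Rightarrow> real"
  assumes diff: "\<And>x i. (\<forall>j. \<bar>x $ j - t0 $ j\<bar> \<le> h) \<Longrightarrow> (\<lambda>s. \<phi> (x + s *\<^sub>R axis i 1)) differentiable (at 0)"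
    and osc: "\<And>x i. (\<forall>j. \<bar>x $ j - t0 $ j\<bar> \<le> h) \<Longrightarrow> \<bar>partial_deriv \<phi> i x - partial_deriv \<phi> i t0\<bar> \<le> B"
    and t: "\<And>j. \<bar>t $ j - t0 $ j\<bar> \<le> h"
  shows "\<bar>\<phi> t - \<phi> t0 - gradient \<phi> t0 \<bullet> (t - t0)\<bar> \<le> real CARD('n) * (B * h)"
proof -
  \<comment> \<open>\<open>pt S\<close> has the coordinates in \<open>S\<close> already moved to
    those of \<open>t\<close>.\<close>
  define pt where "pt = (\<lambda>S. (\<chi> j. if j \<in> S then t $ j else t0 $ j))"
  \<comment> \<open>\<open>undefined\<close> serves as some coordinate index; any other would
    do.\<close>
  have h0: "h \<ge> 0" using t[of undefined] by linarith
  have B0: "B \<ge> 0" using osc[of t0 undefined] h0 by simp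
  have "\<bar>\<phi> (pt S) - \<phi> t0 - (\<Sum>j\<in>S. partial_deriv \<phi> j t0 * (t $ j - t0 $ j))\<bar> \<le> real (card S) * (B * h)" for S
  proof (induction S rule: finite_induct[OF finite])
    case 1
    have "pt {} = t0" by (simp add: pt_def vec_eq_iff)
    thus ?case by simp
  next
    case (2 i S)
    define d where "d = t $ i - t0 $ i"
    define g where "g = (\<lambda>u. \<phi> (pt S + u *\<^sub>R axis i 1) - partial_deriv \<phi> i t0 * u)"
    have comp: "(pt S + u *\<^sub>R axis i 1) $ j = (if j = i then t0 $ i + u else pt S $ j)" for u j
      using 2 by (simp add: pt_def axis_def)
    have box: "\<forall>j. \<bar>(pt S + u *\<^sub>R axis i 1) $ j - t0 $ j\<bar> \<le> h" if "\<bar>u\<bar> \<le> h" for u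
      using that t h0 unfolding comp by (auto simp: pt_def)
    have "norm (g d - g 0) \<le> B * norm (d - 0)"
    proof (rule field_differentiable_bound[where S="{-h..h}" and f'="\<lambda>u. partial_deriv \<phi> i (pt S + u *\<^sub>R axis i 1) - partial_deriv \<phi> i t0"])
      fix u assume u: "u \<in> {-h..h}"
      have "((\<lambda>s. \<phi> (pt S + s *\<^sub>R axis i 1)) has_real_derivative partial_deriv \<phi> i (pt S + u *\<^sub>R axis i 1)) (at u)"
        by (rule partial_deriv_along_axis[OF diff[OF box]]) (use u in auto)
      hence "(g has_field_derivative partial_deriv \<phi> i (pt S + u *\<^sub>R axis i 1) - partial_deriv \<phi> i t0) (at u)"
        unfolding g_def by (auto intro!: derivative_eq_intros)
      thus "(g has_field_derivative partial_deriv \<phi> i (pt S + u *\<^sub>R axis i 1) - partial_deriv \<phi> i t0) (at u within {-h..h})"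
        by (rule has_field_derivative_at_within)
      show "norm (partial_deriv \<phi> i (pt S + u *\<^sub>R axis i 1) - partial_deriv \<phi> i t0) \<le> B"
        using osc[OF box, of u i] u by auto
    qed (use t[of i] h0 in \<open>auto simp: d_def\<close>)
    also have "\<dots> \<le> B * h" using t[of i] B0 by (intro mult_left_mono) (auto simp: d_def)
    finally have st: "\<bar>g d - g 0\<bar> \<le> B * h" by simp
    have "pt S + d *\<^sub>R axis i 1 = pt (insert i S)"
      unfolding vec_eq_iff comp by (simp add: d_def pt_def)
    hence "g d - g 0 = \<phi> (pt (insert i S)) - \<phi> (pt S) - partial_deriv \<phi> i t0 * (t $ i - t0 $ i)"
      by (simp add: g_def d_def)
    with st 2 show ?case by (simp add: ring_distribs abs_le_iff)
  qed
  from this[of UNIV] show ?thesis by (simp add: pt_def gradient_def inner_vec_def)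
qed

section \<open>Counting integer frequencies by volume\<close>

text \<open>Cubes of side 1/|lam| centred at the points k/lam, with k in the rounded image, cover
  \<open>W\<close>, so their total volume is at least \<open>c\<close>. The assumption is a lower
  bound for the outer measure of \<open>W\<close>, phrased through its measurable supersets.\<close>

lemma finite_card_ge_of_uncoverable:
  fixes W :: "(real^'n) set"
  assumes c: "\<And>T. W \<subseteq> T \<Longrightarrow> T \<in> lmeasurable \<Longrightarrow> c \<le> measure lebesgue T" and lam: "lam \<noteq> 0"
  obtains K where "finite K" "K \<subseteq> (\<lambda>w. \<chi> j. round (lam * w $ j)) ` W" "c * \<bar>lam\<bar> ^ CARD('n) \<le> real (card K)"
proof (cases "finite ((\<lambda>w. (\<chi> j. round (lam * w $ j)) :: int^'n) ` W)")
  \<comment> \<open>An infinite image contains finite subsets of any prescribed cardinality.\<close>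
  case False
  obtain N where N: "c * \<bar>lam\<bar> ^ CARD('n) \<le> real N" using real_arch_simple by blast
  obtain K where "K \<subseteq> (\<lambda>w. (\<chi> j. round (lam * w $ j)) :: int^'n) ` W" "finite K" "card K = N"
    using infinite_arbitrarily_large[OF False] by metis
  with N that show ?thesis by blast
next
  case True
  define K where "K = (\<lambda>w. (\<chi> j. round (lam * w $ j)) :: int^'n) ` W"
  define C where "C = (\<lambda>k :: int^'n. cbox (\<chi> j. of_int (k $ j) / lam - 1 / (2 * \<bar>lam\<bar>)) (\<chi> j. of_int (k $ j) / lam + 1 / (2 * \<bar>lam\<bar>)) :: (real^'n) set)"
  have mC: "measure lebesgue (C k) = (1 / \<bar>lam\<bar>) ^ CARD('n)" for k
  proof -
    have ne: "C k \<noteq> {}" using lam unfolding C_def interval_ne_empty_cart by auto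
    have "measure lebesgue (C k) = measure lborel (C k)" unfolding C_def by simp
    also have "\<dots> = (1 / \<bar>lam\<bar>) ^ CARD('n)"
      using ne unfolding C_def by (subst content_cbox_cart) (auto simp: field_simps)
    finally show ?thesis .
  qed
  have "W \<subseteq> (\<Union>k\<in>K. C k)"
  proof
    fix w assume w: "w \<in> W"
    define k where "k = ((\<chi> j. round (lam * w $ j)) :: int^'n)"
    have "k \<in> K" using w by (auto simp: K_def k_def)
    moreover have "w \<in> C k"
    proof -
      have "\<bar>w $ j - of_int (k $ j) / lam\<bar> \<le> 1 / (2 * \<bar>lam\<bar>)" for j
      proof -
        have "\<bar>of_int (round (lam * w $ j)) - lam * w $ j\<bar> \<le> 1/2" by (rule of_int_round_abs_le)
        hence "\<bar>lam\<bar> * \<bar>w $ j - of_int (k $ j) / lam\<bar> \<le> 1/2"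
          using lam unfolding abs_mult[symmetric] k_def by (simp add: right_diff_distrib abs_minus_commute)
        thus ?thesis using lam by (simp add: field_simps)
      qed
      thus ?thesis unfolding C_def mem_box_cart by (simp add: abs_le_iff) (smt (verit))
    qed
    ultimately show "w \<in> (\<Union>k\<in>K. C k)" by blast
  qed
  hence "c \<le> measure lebesgue (\<Union>k\<in>K. C k)"
    using True by (intro c fmeasurable.finite_UN) (auto simp: K_def C_def)
  also have "\<dots> \<le> (\<Sum>k\<in>K. measure lebesgue (C k))"
    using True by (intro measure_UNION_le) (auto simp: K_def C_def)
  also have "\<dots> = real (card K) * (1 / \<bar>lam\<bar>) ^ CARD('n)" by (simp add: mC)
  finally have "c * \<bar>lam\<bar> ^ CARD('n) \<le> real (card K)"
    using lam by (simp add: power_divide field_simps)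
  thus ?thesis using that[of K] True by (simp add: K_def)
qed

section \<open>Lower bound for one localised coefficient\<close>

lemma tent_prod_eq_0:
  assumes "0 < h" "\<not> (\<forall>j. \<bar>t $ j - t0 $ j\<bar> \<le> h)"
  shows "tent_prod h t0 t = 0"
proof -
  obtain j where "\<bar>t $ j - t0 $ j\<bar> > h" using assms(2) not_le by blast
  hence "tent h (t $ j - t0 $ j) = 0" using assms(1) by (simp add: tent_def)
  thus ?thesis unfolding tent_prod_def by (intro prod_zero) auto
qed

text \<open>After multiplication by \<open>cis (- b)\<close> the real part of the integrand is the
  tent product times the cosine of an angle of size at most 1, hence nonnegative. On the concentric
  cube \<open>J\<close> of half the side, whose volume is \<open>h ^ CARD('n)\<close>, the cosine
  and every tent are at least 1/2.\<close>

lemma localized_coefficient_lower_bound: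
  fixes F :: "real^'n \<Rightarrow> complex"
  assumes F: "F absolutely_integrable_on torus_cube" and h: "0 < h"
    and t0: "\<And>j. h \<le> t0 $ j" "\<And>j. t0 $ j \<le> 2 * pi - h"
    and FE: "\<And>t. (\<forall>j. \<bar>t $ j - t0 $ j\<bar> \<le> h) \<Longrightarrow> F t = cis (\<psi> t)"
    and phase: "\<And>t. (\<forall>j. \<bar>t $ j - t0 $ j\<bar> \<le> h) \<Longrightarrow> \<bar>\<psi> t - int_inner k t - b\<bar> \<le> 1"
  shows "(h / 2) ^ CARD('n) / 2 \<le> norm (integral torus_cube (\<lambda>t. F t * (of_real (tent_prod h t0 t) * cis (- int_inner k t))))"
proof -
  define f where "f = (\<lambda>t. F t * (of_real (tent_prod h t0 t) * cis (- int_inner k t)))"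
  have "f absolutely_integrable_on torus_cube" unfolding f_def tent_prod_def tent_def
    using h by (intro absolutely_integrable_mult_continuous F continuous_intros) auto
  hence fi: "f integrable_on torus_cube" by (rule set_lebesgue_integral_eq_integral(1))
  define J where "J = cbox (\<chi> j. t0 $ j - h / 2) (\<chi> j. t0 $ j + h / 2)"
  have memJ: "t \<in> J \<longleftrightarrow> (\<forall>j. \<bar>t $ j - t0 $ j\<bar> \<le> h / 2)" for t
  proof -
    have "(t0 $ j - h / 2 \<le> t $ j \<and> t $ j \<le> t0 $ j + h / 2) \<longleftrightarrow> \<bar>t $ j - t0 $ j\<bar> \<le> h / 2" for j
      by arith
    thus ?thesis by (simp add: J_def mem_box_cart)
  qed
  have Jsub: "J \<subseteq> torus_cube"
  proof
    fix t assume "t \<in> J"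
    hence "t0 $ j - h / 2 \<le> t $ j \<and> t $ j \<le> t0 $ j + h / 2" for j by (simp add: J_def mem_box_cart)
    thus "t \<in> torus_cube" unfolding mem_torus_cube using t0 h by (smt (verit) field_sum_of_halves)
  qed
  have bound: "(if t \<in> J then (1/2) ^ CARD('n) / 2 else 0) \<le> Re (cis (- b) * f t)" for t
  proof (cases "\<forall>j. \<bar>t $ j - t0 $ j\<bar> \<le> h")
    \<comment> \<open>Off this box nothing is known about \<open>F\<close>, but the tent product
      vanishes there.\<close>
    case False
    have "t \<notin> J"
    proof
      assume "t \<in> J"
      hence "\<bar>t $ j - t0 $ j\<bar> \<le> h / 2" for j using memJ by blast
      hence "\<bar>t $ j - t0 $ j\<bar> \<le> h" for j by (rule order_trans) (use h in simp)
      thus False using False by blast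
    qed
    thus ?thesis using tent_prod_eq_0[OF h False] by (simp add: f_def)
  next
    case True
    define \<theta> where "\<theta> = \<psi> t - int_inner k t - b"
    have "cis (- b) * f t = of_real (tent_prod h t0 t) * cis \<theta>"
      unfolding f_def FE[OF True] \<theta>_def by (simp add: cis_mult mult.left_commute algebra_simps)
    hence re: "Re (cis (- b) * f t) = tent_prod h t0 t * cos \<theta>" by simp
    have "\<bar>\<theta>\<bar> \<le> 1" using phase[OF True] by (simp add: \<theta>_def)
    \<comment> \<open>Since 1 < pi / 3, the cosine is at least 1/2.\<close>
    hence "cos (pi / 3) \<le> cos \<bar>\<theta>\<bar>" using pi_gt3 by (intro cos_monotone_0_pi_le) auto
    hence c: "1/2 \<le> cos \<theta>" by (simp add: cos_60)
    have p0: "0 \<le> tent_prod h t0 t" unfolding tent_prod_def by (intro prod_nonneg) (simp add: tent_bounds[OF h])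
    show ?thesis
    proof (cases "t \<in> J")
      case tJ: True
      have "(1/2) ^ CARD('n) = (\<Prod>j\<in>(UNIV :: 'n set). (1/2 :: real))" by simp
      also have "\<dots> \<le> tent_prod h t0 t" unfolding tent_prod_def
      proof (intro prod_mono conjI)
        fix j
        have "\<bar>t $ j - t0 $ j\<bar> \<le> h / 2" using tJ memJ by blast
        thus "1/2 \<le> tent h (t $ j - t0 $ j)" using h by (simp add: tent_def field_simps)
      qed auto
      finally have "(1/2) ^ CARD('n) * (1/2) \<le> tent_prod h t0 t * cos \<theta>" using c p0 by (intro mult_mono) auto
      thus ?thesis using tJ re by simp
    qed (use p0 c re in auto)
  qed
  have cont: "measure lborel J = h ^ CARD('n)"
  proof -
    have ne: "J \<noteq> {}" using h unfolding J_def interval_ne_empty_cart by auto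
    thus ?thesis unfolding J_def by (subst content_cbox_cart) auto
  qed
  have "((\<lambda>t. (1/2) ^ CARD('n) / 2 :: real) has_integral (measure lborel J *\<^sub>R ((1/2) ^ CARD('n) / 2))) J"
    unfolding J_def by (rule has_integral_const)
  hence hi: "((\<lambda>t. if t \<in> J then (1/2) ^ CARD('n) / 2 else 0 :: real) has_integral (measure lborel J *\<^sub>R ((1/2) ^ CARD('n) / 2))) torus_cube"
    by (subst has_integral_restrict[OF Jsub])
  have hr: "((\<lambda>t. Re (cis (- b) * f t)) has_integral Re (cis (- b) * integral torus_cube f)) torus_cube"
    using has_integral_linear[OF has_integral_mult_right[OF integrable_integral[OF fi]] bounded_linear_Re]
    unfolding o_def .
  have "(h / 2) ^ CARD('n) / 2 = measure lborel J *\<^sub>R ((1/2) ^ CARD('n) / 2)"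
    by (simp add: cont power_divide)
  also have "\<dots> \<le> Re (cis (- b) * integral torus_cube f)"
    by (rule has_integral_le[OF hi hr bound])
  also have "\<dots> \<le> norm (cis (- b) * integral torus_cube f)" by (rule complex_Re_le_cmod)
  also have "\<dots> = norm (integral torus_cube f)" by (simp add: norm_mult)
  finally show ?thesis by (simp add: f_def)
qed

subsection \<open>Counting frequencies\<close>

lemma dist_le_of_coordinates:
  fixes x y :: "real^'n"
  assumes "\<And>j. \<bar>x $ j - y $ j\<bar> \<le> h"
  shows "dist x y \<le> real CARD('n) * h"
proof -
  have "dist x y \<le> (\<Sum>j\<in>UNIV. \<bar>(x - y) $ j\<bar>)" unfolding dist_norm by (rule norm_le_l1_cart)
  also have "\<dots> \<le> (\<Sum>j\<in>(UNIV :: 'n set). h)" using assms by (intro sum_mono) simp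
  finally show ?thesis by simp
qed

text \<open>The open set is the countable union of its parts at depth 1/(k+1), measured by boxes; if
  the images of all parts were null, so would be the whole image. Fixing one non-null part gives a
  margin \<open>r\<close> and an outer measure bound \<open>c\<close> that serve all sufficiently
  small scales.\<close>

lemma exists_interior_with_large_gradient_image:
  fixes V :: "(real^'n) set" and g :: "real^'n \<Rightarrow> real^'n"
  assumes "open V" and pos: "emeasure lebesgue (g ` V) > 0"
  obtains r c where "r > 0" "c > 0"
    "\<And>T. g ` {x \<in> V. \<forall>y. (\<forall>j. \<bar>y $ j - x $ j\<bar> \<le> r) \<longrightarrow> y \<in> V} \<subseteq> T \<Longrightarrow> T \<in> lmeasurable \<Longrightarrow> c \<le> measure lebesgue T"
proof -
  define U where "U = (\<lambda>r. {x \<in> V. \<forall>y. (\<forall>j. \<bar>y $ j - x $ j\<bar> \<le> r) \<longrightarrow> y \<in> V})"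
  have UN: "V = (\<Union>k. U (1 / real (Suc k)))"
  proof (intro equalityI subsetI)
    fix x assume x: "x \<in> V"
    then obtain e where e: "e > 0" "ball x e \<subseteq> V" using assms(1) open_contains_ball by blast
    \<comment> \<open>The Euclidean distance is at most the dimension times the box radius, hence
      the division.\<close>
    have "e / real CARD('n) > 0" using e by simp
    then obtain k where k: "1 / real (Suc k) < e / real CARD('n)" using nat_approx_posE by metis
    have "y \<in> V" if y: "\<forall>j. \<bar>y $ j - x $ j\<bar> \<le> 1 / real (Suc k)" for y
    proof -
      have "dist y x \<le> real CARD('n) * (1 / real (Suc k))" using y by (intro dist_le_of_coordinates) auto
      also have "\<dots> < real CARD('n) * (e / real CARD('n))" using k by (intro mult_strict_left_mono) auto
      finally have "dist x y < e" by (simp add: dist_commute)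
      thus ?thesis using e by auto
    qed
    thus "x \<in> (\<Union>k. U (1 / real (Suc k)))" using x by (auto simp: U_def)
  qed (auto simp: U_def)
  have "\<exists>k. \<not> negligible (g ` U (1 / real (Suc k)))"
  proof (rule ccontr)
    assume "\<not> ?thesis"
    hence "(\<Union>k. g ` U (1 / real (Suc k))) \<in> null_sets lebesgue"
      by (intro null_sets_UN) (auto simp: negligible_iff_null_sets)
    also have "(\<Union>k. g ` U (1 / real (Suc k))) = g ` V" by (subst UN) (rule image_UN[symmetric])
    finally show False using pos by auto
  qed
  then obtain k where "\<not> negligible (g ` U (1 / real (Suc k)))" by blast
  \<comment> \<open>A set that is not negligible has no measurable supersets of arbitrarily small
    measure.\<close>
  then obtain c where "c > 0" "\<And>T. g ` U (1 / real (Suc k)) \<subseteq> T \<Longrightarrow> T \<in> lmeasurable \<Longrightarrow> c \<le> measure lebesgue T"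
    unfolding negligible_outer by (meson not_le)
  thus ?thesis using that[of "1 / real (Suc k)" c] by (simp add: U_def)
qed

lemma C1_omega_uniform:
  fixes V :: "(real^'n) set"
  assumes "C1_omega \<omega> V \<phi>" and w: "\<And>\<delta>. 0 \<le> \<delta> \<Longrightarrow> 0 \<le> \<omega> \<delta>"
  obtains C d where "C > 0" "d > 0"
    "\<And>i \<delta> x y. 0 < \<delta> \<Longrightarrow> \<delta> < d \<Longrightarrow> x \<in> V \<Longrightarrow> y \<in> V \<Longrightarrow> dist x y \<le> \<delta> \<Longrightarrow>
       \<bar>partial_deriv \<phi> i x - partial_deriv \<phi> i y\<bar> \<le> C * \<omega> \<delta>"
proof -
  have "\<forall>i. \<exists>C \<delta>0. \<delta>0 > 0 \<and> (\<forall>\<delta>. 0 < \<delta> \<and> \<delta> < \<delta>0 \<longrightarrow>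
        (\<forall>t1\<in>V. \<forall>t2\<in>V. dist t1 t2 \<le> \<delta> \<longrightarrow>
           \<bar>partial_deriv \<phi> i t1 - partial_deriv \<phi> i t2\<bar> \<le> C * \<omega> \<delta>))"
    using assms(1) by (simp add: C1_omega_def)
  then obtain Ci di where Cd: "\<And>i. di i > 0"
    "\<And>i \<delta> x y. 0 < \<delta> \<Longrightarrow> \<delta> < di i \<Longrightarrow> x \<in> V \<Longrightarrow> y \<in> V \<Longrightarrow> dist x y \<le> \<delta> \<Longrightarrow>
       \<bar>partial_deriv \<phi> i x - partial_deriv \<phi> i y\<bar> \<le> Ci i * \<omega> \<delta>"
    by metis
  \<comment> \<open>One constant for all coordinates: the sum dominates every \<open>Ci i\<close>,
    and the summand 1 makes it positive. Nonnegativity of \<open>\<omega>\<close> permits the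
    enlargement.\<close>
  define C where "C = 1 + (\<Sum>i\<in>UNIV. \<bar>Ci i\<bar>)"
  define d where "d = Min (range di)"
  have "C > 0" unfolding C_def by (rule add_pos_nonneg) (auto intro: sum_nonneg)
  moreover have "d > 0" unfolding d_def using Cd(1) by (subst Min_gr_iff) auto
  moreover have "\<bar>partial_deriv \<phi> i x - partial_deriv \<phi> i y\<bar> \<le> C * \<omega> \<delta>"
    if "0 < \<delta>" "\<delta> < d" "x \<in> V" "y \<in> V" "dist x y \<le> \<delta>" for i \<delta> x y
  proof -
    have "d \<le> di i" unfolding d_def by (intro Min_le) auto
    hence "\<bar>partial_deriv \<phi> i x - partial_deriv \<phi> i y\<bar> \<le> Ci i * \<omega> \<delta>" using that by (intro Cd(2)) auto
    also have "Ci i \<le> C" unfolding C_def using member_le_sum[of i UNIV "\<lambda>i. \<bar>Ci i\<bar>"] by simp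
    hence "Ci i * \<omega> \<delta> \<le> C * \<omega> \<delta>" using w that by (intro mult_right_mono) auto
    finally show ?thesis .
  qed
  ultimately show ?thesis by (rule that)
qed

section \<open>The lower bound for every extension\<close>

text \<open>The scale \<open>\<delta>\<close> is kept free, subject to
  \<open>\<bar>lam\<bar> * (\<delta> * \<omega> \<delta>) \<le> 1\<close> and the a priori bound
  \<open>M\<close>, which lets \<open>\<epsilon>\<close> and \<open>c\<close> be chosen before
  \<open>lam\<close>. Treating every extension \<open>F\<close> at once allows the passage to the
  infimum.\<close>

lemma Ap_norm_lower_bound_scale:
  fixes V :: "(real^'n) set" and \<phi> :: "real^'n \<Rightarrow> real"
  assumes p: "1 \<le> p" and mono: "mono_on {0..} \<omega>" and w0: "\<omega> 0 = 0"
    and V: "open V" "V \<subseteq> torus_cube" and C1: "C1_omega \<omega> V \<phi>"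
    and pos: "emeasure lebesgue (gradient \<phi> ` V) > 0" and M: "M > 0"
  obtains c where "c > 0"
    "\<And>lam \<delta> F. lam \<noteq> 0 \<Longrightarrow> 0 < \<delta> \<Longrightarrow> \<delta> \<le> M \<Longrightarrow> \<bar>lam\<bar> * (\<delta> * \<omega> \<delta>) \<le> 1 \<Longrightarrow>
            F \<in> Ap_space p \<Longrightarrow> (\<forall>x\<in>V. F x = cis (lam * \<phi> x)) \<Longrightarrow>
            c * (\<bar>lam\<bar> powr (1/p) * \<delta>) ^ CARD('n) \<le> Ap_norm p F"
proof -
  define N where "N = real CARD('n)"
  have N: "N \<ge> 1" by (simp add: N_def Suc_le_eq)
  have wmono: "\<omega> s \<le> \<omega> t" if "0 \<le> s" "s \<le> t" for s t using mono that by (auto simp: mono_on_def)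
  have wnn: "0 \<le> \<omega> s" if "0 \<le> s" for s using wmono[of 0 s] that w0 by simp
  obtain C d where C: "C > 0" and d: "d > 0" and osc:
    "\<And>i \<delta> x y. 0 < \<delta> \<Longrightarrow> \<delta> < d \<Longrightarrow> x \<in> V \<Longrightarrow> y \<in> V \<Longrightarrow> dist x y \<le> \<delta> \<Longrightarrow>
       \<bar>partial_deriv \<phi> i x - partial_deriv \<phi> i y\<bar> \<le> C * \<omega> \<delta>"
    using C1_omega_uniform[OF C1 wnn] by blast
  obtain r c0 where r: "r > 0" and c0: "c0 > 0" and cov:
    "\<And>T. gradient \<phi> ` {x \<in> V. \<forall>y. (\<forall>j. \<bar>y $ j - x $ j\<bar> \<le> r) \<longrightarrow> y \<in> V} \<subseteq> T \<Longrightarrow> T \<in> lmeasurable \<Longrightarrow> c0 \<le> measure lebesgue T"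
    using exists_interior_with_large_gradient_image[OF V(1) pos] by blast
  define U where "U = {x \<in> V. \<forall>y. (\<forall>j. \<bar>y $ j - x $ j\<bar> \<le> r) \<longrightarrow> y \<in> V}"
  \<comment> \<open>In order, the entries ensure \<open>N * h \<le> \<delta>\<close> (so that
    \<open>\<omega> \<delta>\<close> governs the oscillation), \<open>N * h < d\<close>, boxes of
    radius \<open>h\<close> inside \<open>V\<close>, a rounding error of at most 1/2, a first-order
    remainder of at most 1/2 after multiplication by \<open>lam\<close>, and
    \<open>h \<le> 2 * pi\<close>.\<close>
  define \<epsilon> where "\<epsilon> = Min {1 / N, d / (2 * N * M), r / M, 1 / (N * M), 1 / (2 * N * C), 2 * pi / M}"
  have e0: "\<epsilon> > 0" unfolding \<epsilon>_def using N d r C M by simp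
  have e_le: "\<epsilon> \<le> 1 / N" "\<epsilon> \<le> d / (2 * N * M)" "\<epsilon> \<le> r / M" "\<epsilon> \<le> 1 / (N * M)" "\<epsilon> \<le> 1 / (2 * N * C)" "\<epsilon> \<le> 2 * pi / M"
    unfolding \<epsilon>_def by (auto intro: Min_le)
  have e: "N * \<epsilon> \<le> 1" "2 * N * (\<epsilon> * M) \<le> d" "\<epsilon> * M \<le> r" "N * (\<epsilon> * M) \<le> 1" "2 * (N * (C * \<epsilon>)) \<le> 1" "\<epsilon> * M \<le> 2 * pi"
    using e_le N M C by (simp_all add: field_simps)
  \<comment> \<open>The first factor comes from counting frequencies; the second is
    \<open>y / (2 * (2 * pi) ^ CARD('n))\<close> at \<open>h = \<epsilon> * \<delta>\<close>, with
    the power of \<open>\<delta>\<close> split off.\<close>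
  define c where "c = c0 powr (1/p) * ((\<epsilon> / 2) ^ CARD('n) / (4 * (2 * pi) ^ CARD('n)))"
  have "c > 0" using c0 e0 by (simp add: c_def)
  moreover have "c * (\<bar>lam\<bar> powr (1/p) * \<delta>) ^ CARD('n) \<le> Ap_norm p F"
    if lam: "lam \<noteq> 0" and \<delta>: "0 < \<delta>" "\<delta> \<le> M" "\<bar>lam\<bar> * (\<delta> * \<omega> \<delta>) \<le> 1"
      and F: "F \<in> Ap_space p" and FV: "\<forall>x\<in>V. F x = cis (lam * \<phi> x)" for lam \<delta> F
  proof -
    define h where "h = \<epsilon> * \<delta>"
    have h0: "h > 0" using e0 \<delta> by (simp add: h_def)
    have hM: "h \<le> \<epsilon> * M" using e0 \<delta> by (simp add: h_def)
    have h1: "N * h \<le> \<delta>" using mult_right_mono[OF e(1), of \<delta>] \<delta> by (simp add: h_def mult.assoc)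
    have NhM: "N * h \<le> N * (\<epsilon> * M)" using hM N by (intro mult_left_mono) auto
    have Nh0: "N * h > 0" using h0 N by simp
    have h2: "N * h < d" using NhM e(2) Nh0 by (simp add: mult.assoc)
    have h3: "h \<le> r" "h \<le> 2 * pi" using hM e by auto
    have h4: "N * h \<le> 1" using NhM e(4) by linarith
    \<comment> \<open>The scale condition enters here: the first-order error stays bounded after
      multiplication by \<open>\<bar>lam\<bar>\<close>.\<close>
    have h5: "\<bar>lam\<bar> * (N * (C * \<omega> \<delta> * h)) \<le> 1/2"
    proof -
      have "\<bar>lam\<bar> * (N * (C * \<omega> \<delta> * h)) = (N * (C * \<epsilon>)) * (\<bar>lam\<bar> * (\<delta> * \<omega> \<delta>))"
        by (simp add: h_def mult_ac)
      also have "\<dots> \<le> (N * (C * \<epsilon>)) * 1"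
        using \<delta>(3) N C e0 by (intro mult_left_mono) auto
      finally show ?thesis using e(5) by linarith
    qed
    have boxV: "x \<in> V" if "t0 \<in> U" "\<forall>j. \<bar>x $ j - t0 $ j\<bar> \<le> h" for x t0
    proof -
      have "\<forall>j. \<bar>x $ j - t0 $ j\<bar> \<le> r" using that(2) h3(1) order_trans by blast
      thus ?thesis using that(1) by (simp add: U_def)
    qed
    obtain K where K: "finite K" "K \<subseteq> (\<lambda>w. \<chi> j. round (lam * w $ j)) ` gradient \<phi> ` U"
      "c0 * \<bar>lam\<bar> ^ CARD('n) \<le> real (card K)"
      by (rule finite_card_ge_of_uncoverable[OF cov[folded U_def] lam])
    define y where "y = (h / 2) ^ CARD('n) / 2"
    have "real (card K) powr (1/p) * (y / (2 * (2 * pi) ^ CARD('n))) \<le> Ap_norm p F"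
    proof (rule Ap_norm_ge_card[OF F p h0 h3(2) _ K(1)])
      show "y > 0" using h0 by (simp add: y_def)
      fix k assume "k \<in> K"
      then obtain t0 where t0: "t0 \<in> U" and k: "k = (\<chi> j. round (lam * gradient \<phi> t0 $ j))" using K(2) by blast
      have t0V: "t0 \<in> V" using t0 by (simp add: U_def)
      \<comment> \<open>Two opposite corners of the box around \<open>t0\<close> lie in
        \<open>V\<close>, hence in the torus cube.\<close>
      have lo: "h \<le> t0 $ j" and hi: "t0 $ j \<le> 2 * pi - h" for j
      proof -
        have "(\<chi> i. t0 $ i - h) \<in> torus_cube" "(\<chi> i. t0 $ i + h) \<in> torus_cube"
          using boxV[OF t0, of "\<chi> i. t0 $ i - h"] boxV[OF t0, of "\<chi> i. t0 $ i + h"] h0 V(2) by auto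
        hence "0 \<le> t0 $ j - h" "t0 $ j + h \<le> 2 * pi" unfolding mem_torus_cube vec_lambda_beta by blast+
        thus "h \<le> t0 $ j" "t0 $ j \<le> 2 * pi - h" by auto
      qed
      \<comment> \<open>\<open>b\<close> is the phase left at \<open>t0\<close> after subtracting
        the linear phase of frequency \<open>k\<close>.\<close>
      define b where "b = lam * \<phi> t0 - int_inner k t0"
      have "y \<le> norm (integral torus_cube (\<lambda>t. F t * (of_real (tent_prod h t0 t) * cis (- int_inner k t))))"
        unfolding y_def
      proof (rule localized_coefficient_lower_bound[where \<psi>="\<lambda>t. lam * \<phi> t" and b=b, OF _ h0 lo hi])
        show "F absolutely_integrable_on torus_cube" using F by (simp add: Ap_space_def)
        fix t assume t: "\<forall>j. \<bar>t $ j - t0 $ j\<bar> \<le> h"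
        show "F t = cis (lam * \<phi> t)" using FV boxV[OF t0 t] by blast
        have A: "\<bar>\<phi> t - \<phi> t0 - gradient \<phi> t0 \<bullet> (t - t0)\<bar> \<le> N * (C * \<omega> \<delta> * h)"
          unfolding N_def
        proof (rule first_order_approx_box)
          fix x i assume x: "\<forall>j. \<bar>x $ j - t0 $ j\<bar> \<le> h"
          have xV: "x \<in> V" by (rule boxV[OF t0 x])
          show "(\<lambda>s. \<phi> (x + s *\<^sub>R axis i 1)) differentiable (at 0)" using C1 xV by (simp add: C1_omega_def)
          have "dist x t0 \<le> N * h" unfolding N_def using x by (intro dist_le_of_coordinates) auto
          hence "\<bar>partial_deriv \<phi> i x - partial_deriv \<phi> i t0\<bar> \<le> C * \<omega> (N * h)"
            by (rule osc[OF Nh0 h2 xV t0V])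
          also have "\<dots> \<le> C * \<omega> \<delta>" using wmono[OF _ h1] Nh0 C by (intro mult_left_mono) auto
          finally show "\<bar>partial_deriv \<phi> i x - partial_deriv \<phi> i t0\<bar> \<le> C * \<omega> \<delta>" .
        qed (use t in auto)
        \<comment> \<open>As \<open>k\<close> rounds \<open>lam\<close> times the gradient, each
          coordinate contributes at most \<open>h / 2\<close>.\<close>
        have B: "\<bar>lam * (gradient \<phi> t0 \<bullet> (t - t0)) - int_inner k (t - t0)\<bar> \<le> 1/2"
        proof -
          have "lam * (gradient \<phi> t0 \<bullet> (t - t0)) - int_inner k (t - t0)
             = (\<Sum>j\<in>UNIV. (lam * gradient \<phi> t0 $ j - of_int (k $ j)) * (t $ j - t0 $ j))"
            by (simp add: inner_vec_def int_inner_def sum_distrib_left left_diff_distrib sum_subtractf mult.assoc)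
          also have "\<bar>\<dots>\<bar> \<le> (\<Sum>j\<in>(UNIV :: 'n set). 1/2 * h)"
          proof (rule order_trans[OF sum_abs], rule sum_mono)
            fix j
            have "\<bar>lam * gradient \<phi> t0 $ j - of_int (k $ j)\<bar> \<le> 1/2"
              unfolding k vec_lambda_beta using of_int_round_abs_le[of "lam * gradient \<phi> t0 $ j"]
              by (simp add: abs_minus_commute)
            thus "\<bar>(lam * gradient \<phi> t0 $ j - of_int (k $ j)) * (t $ j - t0 $ j)\<bar> \<le> 1/2 * h"
              unfolding abs_mult using t by (intro mult_mono) auto
          qed
          also have "\<dots> = N * h / 2" by (simp add: N_def)
          finally show ?thesis using h4 by linarith
        qed
        have "\<bar>lam * (\<phi> t - \<phi> t0 - gradient \<phi> t0 \<bullet> (t - t0))\<bar> \<le> 1/2"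
          unfolding abs_mult using mult_left_mono[OF A, of "\<bar>lam\<bar>"] h5 by linarith
        moreover have "lam * \<phi> t - int_inner k t - b = lam * (\<phi> t - \<phi> t0 - gradient \<phi> t0 \<bullet> (t - t0))
            + (lam * (gradient \<phi> t0 \<bullet> (t - t0)) - int_inner k (t - t0))"
          by (simp add: b_def int_inner_diff_right algebra_simps)
        ultimately show "\<bar>lam * \<phi> t - int_inner k t - b\<bar> \<le> 1" using B by linarith
      qed
      thus "\<exists>t0. (\<forall>j. h \<le> t0 $ j \<and> t0 $ j \<le> 2 * pi - h) \<and>
         y \<le> norm (integral torus_cube (\<lambda>t. F t * (of_real (tent_prod h t0 t) * cis (- int_inner k t))))"
        using lo hi by (intro exI[of _ t0]) simp
    qed
    moreover have "c * (\<bar>lam\<bar> powr (1/p) * \<delta>) ^ CARD('n) =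
        (c0 * \<bar>lam\<bar> ^ CARD('n)) powr (1/p) * (y / (2 * (2 * pi) ^ CARD('n)))"
    proof -
      have "(\<bar>lam\<bar> ^ CARD('n)) powr (1/p) = (\<bar>lam\<bar> powr (1/p)) ^ CARD('n)"
        using lam powr_realpow[of "\<bar>lam\<bar>" "CARD('n)"] powr_realpow[of "\<bar>lam\<bar> powr (1/p)" "CARD('n)"]
          powr_powr[of "\<bar>lam\<bar>" "real CARD('n)" "1/p"] powr_powr[of "\<bar>lam\<bar>" "1/p" "real CARD('n)"]
        by (simp add: mult.commute)
      thus ?thesis using c0 by (simp add: c_def y_def h_def powr_mult power_mult_distrib power_divide mult_ac)
    qed
    moreover have "(c0 * \<bar>lam\<bar> ^ CARD('n)) powr (1/p) * (y / (2 * (2 * pi) ^ CARD('n)))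
        \<le> real (card K) powr (1/p) * (y / (2 * (2 * pi) ^ CARD('n)))"
      using K(3) p c0 h0 by (intro mult_right_mono powr_mono2) (auto simp: y_def)
    ultimately show ?thesis by linarith
  qed
  ultimately show ?thesis by (rule that)
qed

section \<open>The inverse of chi and the conclusion\<close>

text \<open>Since \<open>\<omega>\<close> may vanish near 0, strict growth of
  \<open>\<delta> * \<omega> \<delta>\<close> is available only where it is positive; a positive
  \<open>y\<close> therefore has at most one preimage, which makes the definite description in
  \<open>chi_inv\<close> meaningful. Existence is the intermediate value theorem on
  \<open>{0..a}\<close>.\<close>

lemma chi_inv_eq:
  assumes mono: "mono_on {0..} \<omega>" and w0: "\<omega> 0 = 0" and cont: "continuous_on {0..} \<omega>"
    and a: "0 \<le> a" "1 \<le> a * \<omega> a" and y: "0 < y" "y \<le> 1"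
  shows "0 < chi_inv \<omega> y" "chi_inv \<omega> y \<le> a" "chi_inv \<omega> y * \<omega> (chi_inv \<omega> y) = y"
proof -
  have wmono: "\<omega> s \<le> \<omega> t" if "0 \<le> s" "s \<le> t" for s t using mono that by (auto simp: mono_on_def)
  have strict: "s * \<omega> s < t * \<omega> t" if "0 \<le> s" "s < t" "0 < t * \<omega> t" for s t
  proof -
    have wt: "0 < \<omega> t" using that by (simp add: zero_less_mult_iff)
    have "s * \<omega> s \<le> s * \<omega> t" using wmono that by (intro mult_left_mono) auto
    also have "\<dots> < t * \<omega> t" using wt that by (intro mult_strict_right_mono) auto
    finally show ?thesis .
  qed
  have "\<exists>x\<ge>0. x \<le> a \<and> x * \<omega> x = y"
  proof (rule IVT')
    show "continuous_on {0..a} (\<lambda>x. x * \<omega> x)"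
      by (intro continuous_intros continuous_on_subset[OF cont]) auto
  qed (use a y in auto)
  then obtain x where x: "0 \<le> x" "x \<le> a" "x * \<omega> x = y" by blast
  have "chi_inv \<omega> y = x" unfolding chi_inv_def
  proof (rule the_equality)
    fix z assume z: "0 \<le> z \<and> z * \<omega> z = y"
    show "z = x" using strict[of z x] strict[of x z] z x(1,3) y(1) by (cases z x rule: linorder_cases) auto
  qed (use x in simp)
  moreover have "x \<noteq> 0" using x y by auto
  ultimately show "0 < chi_inv \<omega> y" "chi_inv \<omega> y \<le> a" "chi_inv \<omega> y * \<omega> (chi_inv \<omega> y) = y" using x by auto
qed

text \<open>Excludes the junk case of \<^const>\<open>chi_inv\<close>: if \<open>\<omega>\<close> vanished identically, no \<open>\<delta>\<close> would solve
  \<open>\<delta> * \<omega> \<delta> = 1 / \<bar>lam\<bar>\<close>, but then the gradient would be locally constant on the connected set \<open>V\<close>.\<close>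

lemma C1_omega_modulus_nontrivial:
  fixes V :: "(real^'n) set"
  assumes mono: "mono_on {0..} \<omega>" and w0: "\<omega> 0 = 0"
    and V: "connected V" and C1: "C1_omega \<omega> V \<phi>"
    and pos: "emeasure lebesgue (gradient \<phi> ` V) > 0"
  obtains a where "a > 0" "\<omega> a > 0"
proof -
  have wmono: "\<omega> s \<le> \<omega> t" if "0 \<le> s" "s \<le> t" for s t using mono that by (auto simp: mono_on_def)
  have wnn: "0 \<le> \<omega> s" if "0 \<le> s" for s using wmono[of 0 s] that w0 by simp
  obtain C d where C: "C > 0" and d: "d > 0" and osc:
    "\<And>i \<delta> x y. 0 < \<delta> \<Longrightarrow> \<delta> < d \<Longrightarrow> x \<in> V \<Longrightarrow> y \<in> V \<Longrightarrow> dist x y \<le> \<delta> \<Longrightarrow>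
       \<bar>partial_deriv \<phi> i x - partial_deriv \<phi> i y\<bar> \<le> C * \<omega> \<delta>"
    using C1_omega_uniform[OF C1 wnn] by blast
  show ?thesis
  proof (cases "\<omega> (d / 2) = 0")
    case True
    have loc: "gradient \<phi> x = gradient \<phi> y" if "x \<in> V" "y \<in> V" "dist x y \<le> d / 2" for x y
      using osc[of "d / 2" x y] that d True by (simp add: gradient_def vec_eq_iff)
    have const: "gradient \<phi> x = gradient \<phi> y" if "x \<in> V" "y \<in> V" for x y
    proof (rule connected_local_const[OF V that])
      show "\<forall>a\<in>V. \<forall>\<^sub>F b in at a within V. gradient \<phi> a = gradient \<phi> b"
      proof
        fix a assume a: "a \<in> V"
        show "\<forall>\<^sub>F b in at a within V. gradient \<phi> a = gradient \<phi> b"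
          unfolding eventually_at
        proof (intro exI[of _ "d / 2"] conjI ballI impI)
          fix b assume "b \<in> V" "b \<noteq> a \<and> dist b a < d / 2"
          thus "gradient \<phi> a = gradient \<phi> b" by (intro loc a) (auto simp: dist_commute)
        qed (use d in simp)
      qed
    qed
    have "\<exists>u. gradient \<phi> ` V \<subseteq> {u}"
    proof (cases "V = {}")
      case False
      then obtain x where "x \<in> V" by blast
      thus ?thesis using const by blast
    qed auto
    hence "negligible (gradient \<phi> ` V)" using negligible_subset[OF negligible_sing] by blast
    hence "emeasure lebesgue (gradient \<phi> ` V) = 0" by (metis negligible_iff_null_sets null_setsD1)
    thus ?thesis using pos by simp
  next
    case False
    thus ?thesis using that[of "d / 2"] d wnn[of "d / 2"] by simp
  qed
qed

theorem mainTheorem4: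
  fixes \<omega> :: "real \<Rightarrow> real" and V :: "(real^'n) set" and \<phi> :: "real^'n \<Rightarrow> real"
    and p :: real
  assumes "1 \<le> p" "p < 2"
    and "continuous_on {0..} \<omega>" "mono_on {0..} \<omega>" "\<omega> 0 = 0"
    and "open V" "connected V" "V \<noteq> {}" "V \<subseteq> torus_cube"
    and "C1_omega \<omega> V \<phi>"
    and "emeasure lebesgue (gradient \<phi> ` V) > 0"
  shows "\<exists>c>0. \<forall>lam::real. \<bar>lam\<bar> \<ge> 1 \<and>
            (\<lambda>x. cis (lam * \<phi> x)) \<in> Ap_on p V \<longrightarrow>
            Ap_on_norm p V (\<lambda>x. cis (lam * \<phi> x))
              \<ge> c * (\<bar>lam\<bar> powr (1/p) * chi_inv \<omega> (1 / \<bar>lam\<bar>)) ^ CARD('n)"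
proof -
  obtain a0 where a0: "a0 > 0" "\<omega> a0 > 0"
    using C1_omega_modulus_nontrivial[OF assms(4,5,7,10,11)] .
  \<comment> \<open>This makes \<open>a * \<omega> a\<close> at least 1, so \<open>a\<close> bounds
    the scales for all \<open>\<bar>lam\<bar> \<ge> 1\<close> at once and \<open>c\<close> can be
    fixed before \<open>lam\<close>.\<close>
  define a where "a = max a0 (1 / \<omega> a0)"
  have a: "a > 0" using a0 by (simp add: a_def less_max_iff_disj)
  have "1 = 1 / \<omega> a0 * \<omega> a0" using a0 by simp
  also have "\<dots> \<le> a * \<omega> a"
    using a0 mono_onD[OF assms(4), of a0 a] by (intro mult_mono) (auto simp: a_def le_max_iff_disj)
  finally have a1: "1 \<le> a * \<omega> a" .
  obtain c where c: "c > 0" and low: "\<And>lam \<delta> F. lam \<noteq> 0 \<Longrightarrow> 0 < \<delta> \<Longrightarrow> \<delta> \<le> a \<Longrightarrow> \<bar>lam\<bar> * (\<delta> * \<omega> \<delta>) \<le> 1 \<Longrightarrow>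
            F \<in> Ap_space p \<Longrightarrow> (\<forall>x\<in>V. F x = cis (lam * \<phi> x)) \<Longrightarrow>
            c * (\<bar>lam\<bar> powr (1/p) * \<delta>) ^ CARD('n) \<le> Ap_norm p F"
    by (rule Ap_norm_lower_bound_scale[OF assms(1,4,5,6,9,10,11) a]) blast
  show ?thesis
  proof (intro exI[of _ c] conjI c allI impI)
    fix lam :: real
    assume H: "\<bar>lam\<bar> \<ge> 1 \<and> (\<lambda>x. cis (lam * \<phi> x)) \<in> Ap_on p V"
    define \<delta> where "\<delta> = chi_inv \<omega> (1 / \<bar>lam\<bar>)"
    have "0 \<le> a" "0 < 1 / \<bar>lam\<bar>" "1 / \<bar>lam\<bar> \<le> 1" using H a by (auto simp: field_simps)
    note \<delta> = chi_inv_eq[OF assms(4,5,3) this(1) a1 this(2,3), folded \<delta>_def]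
    \<comment> \<open>Membership in \<open>Ap_on\<close> keeps the infimum from being taken over the
      empty set, where \<open>Inf\<close> would carry no information.\<close>
    have ne: "{Ap_norm p F |F. F \<in> Ap_space p \<and> (\<forall>x\<in>V. F x = cis (lam * \<phi> x))} \<noteq> {}"
      using H by (auto simp: Ap_on_def)
    show "c * (\<bar>lam\<bar> powr (1/p) * chi_inv \<omega> (1 / \<bar>lam\<bar>)) ^ CARD('n) \<le> Ap_on_norm p V (\<lambda>x. cis (lam * \<phi> x))"
      unfolding Ap_on_norm_def \<delta>_def[symmetric]
    proof (rule cInf_greatest[OF ne])
      fix z assume "z \<in> {Ap_norm p F |F. F \<in> Ap_space p \<and> (\<forall>x\<in>V. F x = cis (lam * \<phi> x))}"
      then obtain F where "z = Ap_norm p F" "F \<in> Ap_space p" "\<forall>x\<in>V. F x = cis (lam * \<phi> x)" by blast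
      thus "c * (\<bar>lam\<bar> powr (1/p) * \<delta>) ^ CARD('n) \<le> z"
        using low[of lam \<delta> F] \<delta> H by (cases "lam = 0") simp_all
    qed
  qed
qed

end
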